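(* For all integers $d\ge 2$ and $r\ge 1$, the Neretin group $\mathcal{N}_{d,r}$ is a-T-menable.
   Context: $\mathcal{T}_{d,r}$ is the rooted tree whose root has degree $r$ and all of whose other vertices have degree $d+1$ (i.e. $d$ children). A rooted subforest $F\subset\mathcal{T}_{d,r}$ is admissible if it is finite (possibly empty) and its root, if any, is the root of $\mathcal{T}_{d,r}$. $F^C$ is obtained by deleting the vertices of $F$ and all edges with at least one endpoint in $F$; it is a rooted forest, with set of roots $\lambda(F^C)$ consisting of the children of vertices of $F$ that are not in $F$ (and the root of the tree if $F=\emptyset$). An almost automorphism is an equivalence class of triples $(\psi,F,F')$ with $F,F'$ admissible and $\psi\colon F^C\to F'^C$ a forest isomorphism sending $\lambda(F^C)$ bijectively onto $\lambda(F'^C)$; $(\psi_1,F_1,F_1')$ and $(\psi_2,F_2,F_2')$ are equivalent if there are admissible $F\supset F_1,F_2$ and $F'\supset F_1',F_2'$ such that $\psi_1,\psi_2$ induce the same rooted forest isomorphism $F^C\to F'^C$. The Neretin group $\mathcal{N}_{d,r}=\mathrm{AAut}(\mathcal{T}_{d,r})$ is the group of almost automorphisms. Topology: $\mathrm{Aut}(\mathcal{T}_{d,r})$ (root-preserving automorphisms) carries the compact-open topology coming from its action on the boundary of the tree (equivalently pointwise convergence on vertices), and $\mathcal{N}_{d,r}$ carries the unique group topology for which the inclusion $\mathrm{Aut}(\mathcal{T}_{d,r})\to\mathcal{N}_{d,r}$ is continuous and open. A topological group is a-T-menable if it admits a continuous and (metrically) proper action by affine isometries on a Hilbert space. *)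

theory Defs
  imports
    "HOL-Analysis.Abstract_Metric_Spaces"
    "HOL-Analysis.Product_Topology"
    "HOL-Analysis.Function_Topology"
    "HOL-Algebra.Group_Action"
    "HOL-Algebra.Module"
begin

section \<open>The rooted tree and almost automorphisms\<close>

text \<open>A vertex is the list of child indices read along the path from the root \<^term>\<open>[]\<close> to it:
  the root has the children \<open>[0], \<dots>, [r - 1]\<close>, and a vertex \<open>v \<noteq> []\<close> has the children
  \<open>v @ [0], \<dots>, v @ [d - 1]\<close>.\<close>

definition tree_verts :: "nat \<Rightarrow> nat \<Rightarrow> nat list set" where
  "tree_verts d r = {v. \<forall>i<length v. v ! i < (if i = 0 then r else d)}"

definition is_child :: "nat list \<Rightarrow> nat list \<Rightarrow> bool" where
  "is_child u v \<longleftrightarrow> (\<exists>i. v = u @ [i])"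

definition tree_adj :: "nat list \<Rightarrow> nat list \<Rightarrow> bool" where
  "tree_adj u v \<longleftrightarrow> is_child u v \<or> is_child v u"

text \<open>A subforest containing the root as its only root is determined by its vertices: they form a
  set closed under passing to the parent.\<close>

definition admissible :: "nat \<Rightarrow> nat \<Rightarrow> nat list set \<Rightarrow> bool" where
  "admissible d r F \<longleftrightarrow>
     finite F \<and> F \<subseteq> tree_verts d r \<and> (\<forall>u v. v \<in> F \<and> is_child u v \<longrightarrow> u \<in> F)"

definition co_verts :: "nat \<Rightarrow> nat \<Rightarrow> nat list set \<Rightarrow> nat list set" where
  "co_verts d r F = tree_verts d r - F"

definition co_roots :: "nat \<Rightarrow> nat \<Rightarrow> nat list set \<Rightarrow> nat list set" where
  "co_roots d r F =
     {v \<in> co_verts d r F. \<exists>u\<in>F. is_child u v} \<union> (if F = {} then {[]} else {})"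

text \<open>The complement forests carry the edges induced from the tree. Maps between them are
  \<^const>\<open>undefined\<close> outside their domain, so that they are determined by their values on it.\<close>

definition forest_iso ::
    "nat \<Rightarrow> nat \<Rightarrow> nat list set \<Rightarrow> nat list set \<Rightarrow> (nat list \<Rightarrow> nat list) \<Rightarrow> bool" where
  "forest_iso d r F F' \<psi> \<longleftrightarrow>
     \<psi> \<in> extensional (co_verts d r F) \<and>
     bij_betw \<psi> (co_verts d r F) (co_verts d r F') \<and>
     (\<forall>u\<in>co_verts d r F. \<forall>v\<in>co_verts d r F. tree_adj (\<psi> u) (\<psi> v) \<longleftrightarrow> tree_adj u v) \<and>
     \<psi> ` co_roots d r F = co_roots d r F'"

type_synonym aa_triple = "(nat list \<Rightarrow> nat list) \<times> nat list set \<times> nat list set"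

definition aa_triples :: "nat \<Rightarrow> nat \<Rightarrow> aa_triple set" where
  "aa_triples d r =
     {(\<psi>, F, F'). admissible d r F \<and> admissible d r F' \<and> forest_iso d r F F' \<psi>}"

definition aa_rel :: "nat \<Rightarrow> nat \<Rightarrow> (aa_triple \<times> aa_triple) set" where
  "aa_rel d r =
     {((\<psi>\<^sub>1, F\<^sub>1, F\<^sub>1'), (\<psi>\<^sub>2, F\<^sub>2, F\<^sub>2')).
        (\<psi>\<^sub>1, F\<^sub>1, F\<^sub>1') \<in> aa_triples d r \<and> (\<psi>\<^sub>2, F\<^sub>2, F\<^sub>2') \<in> aa_triples d r \<and>
        (\<exists>F F'. admissible d r F \<and> admissible d r F' \<and>
           F\<^sub>1 \<union> F\<^sub>2 \<subseteq> F \<and> F\<^sub>1' \<union> F\<^sub>2' \<subseteq> F' \<and>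
           restrict \<psi>\<^sub>1 (co_verts d r F) = restrict \<psi>\<^sub>2 (co_verts d r F) \<and>
           forest_iso d r F F' (restrict \<psi>\<^sub>1 (co_verts d r F)))}"

definition aa_class :: "nat \<Rightarrow> nat \<Rightarrow> aa_triple \<Rightarrow> aa_triple set" where
  "aa_class d r t = aa_rel d r `` {t}"

definition tree_aut :: "nat \<Rightarrow> nat \<Rightarrow> (nat list \<Rightarrow> nat list) set" where
  "tree_aut d r = {g. forest_iso d r {} {} g}"

definition aut_to_aa :: "nat \<Rightarrow> nat \<Rightarrow> (nat list \<Rightarrow> nat list) \<Rightarrow> aa_triple set" where
  "aut_to_aa d r g = aa_class d r (g, {}, {})"

text \<open>To multiply two classes, take representatives for which the target forest of the right
  factor is the source forest of the left factor, and compose. The result does not depend on the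
  representatives, so the union below is a single class.\<close>

definition neretin :: "nat \<Rightarrow> nat \<Rightarrow> aa_triple set monoid" where
  "neretin d r =
     \<lparr>carrier = aa_triples d r // aa_rel d r,
      mult = (\<lambda>A B. \<Union>{aa_class d r (compose (co_verts d r F) \<psi> \<phi>, F, F'') | \<psi> \<phi> F F' F''.
                         (\<psi>, F', F'') \<in> A \<and> (\<phi>, F, F') \<in> B}),
      one = aut_to_aa d r (restrict id (tree_verts d r))\<rparr>"

section \<open>Topological groups and the topology of the Neretin group\<close>

definition topological_group :: "('g, 'm) monoid_scheme \<Rightarrow> 'g topology \<Rightarrow> bool" where
  "topological_group G T \<longleftrightarrow>
     group G \<and> topspace T = carrier G \<and>
     continuous_map (prod_topology T T) T (\<lambda>(x, y). x \<otimes>\<^bsub>G\<^esub> y) \<and>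
     continuous_map T T (\<lambda>x. inv\<^bsub>G\<^esub> x)"

text \<open>Pointwise convergence on vertices.\<close>

definition tree_aut_topology :: "nat \<Rightarrow> nat \<Rightarrow> (nat list \<Rightarrow> nat list) topology" where
  "tree_aut_topology d r =
     subtopology
       (product_topology (\<lambda>_. discrete_topology (tree_verts d r)) (tree_verts d r))
       (tree_aut d r)"

definition neretin_topology :: "nat \<Rightarrow> nat \<Rightarrow> aa_triple set topology" where
  "neretin_topology d r =
     (THE T. topological_group (neretin d r) T \<and>
             continuous_map (tree_aut_topology d r) T (aut_to_aa d r) \<and>
             open_map (tree_aut_topology d r) T (aut_to_aa d r))"

section \<open>Hilbert spaces and a-T-menability\<close>

text \<open>The existential quantifier over Hilbert spaces in the definition of a-T-menability cannot
  range over types, so a real Hilbert space is a structure with an explicit carrier. As usual for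
  modules in HOL-Algebra, the multiplicative fields of the record are unused.\<close>

definition real_ring :: "real ring" where
  "real_ring = \<lparr>carrier = UNIV, mult = (*), one = 1, zero = 0, add = (+)\<rparr>"

record 'v inner_space = "(real, 'v) module" +
  ip :: "'v \<Rightarrow> 'v \<Rightarrow> real"

text \<open>The locale \<^locale>\<open>Metric_space\<close> requires a distance to be nonnegative and symmetric also at
  points outside the carrier, so it is set to \<open>0\<close> there.\<close>

definition ip_dist :: "('v, 'm) inner_space_scheme \<Rightarrow> 'v \<Rightarrow> 'v \<Rightarrow> real" where
  "ip_dist V x y =
     (if x \<in> carrier V \<and> y \<in> carrier V
      then sqrt (ip V (x \<ominus>\<^bsub>V\<^esub> y) (x \<ominus>\<^bsub>V\<^esub> y)) else 0)"

definition hilbert_space :: "('v, 'm) inner_space_scheme \<Rightarrow> bool" where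
  "hilbert_space V \<longleftrightarrow>
     Module.module real_ring V \<and>
     (\<forall>x\<in>carrier V. \<forall>y\<in>carrier V. ip V x y = ip V y x) \<and>
     (\<forall>x\<in>carrier V. \<forall>y\<in>carrier V. \<forall>z\<in>carrier V. ip V (x \<oplus>\<^bsub>V\<^esub> y) z = ip V x z + ip V y z) \<and>
     (\<forall>c. \<forall>x\<in>carrier V. \<forall>y\<in>carrier V. ip V (c \<odot>\<^bsub>V\<^esub> x) y = c * ip V x y) \<and>
     (\<forall>x\<in>carrier V. 0 \<le> ip V x x) \<and>
     (\<forall>x\<in>carrier V. ip V x x = 0 \<longrightarrow> x = \<zero>\<^bsub>V\<^esub>) \<and>
     Metric_space.mcomplete (carrier V) (ip_dist V)"

definition ip_topology :: "('v, 'm) inner_space_scheme \<Rightarrow> 'v topology" where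
  "ip_topology V = Metric_space.mtopology (carrier V) (ip_dist V)"

definition affine_isometry :: "('v, 'm) inner_space_scheme \<Rightarrow> ('v \<Rightarrow> 'v) \<Rightarrow> bool" where
  "affine_isometry V A \<longleftrightarrow>
     bij_betw A (carrier V) (carrier V) \<and>
     (\<forall>x\<in>carrier V. \<forall>y\<in>carrier V. ip_dist V (A x) (A y) = ip_dist V x y) \<and>
     (\<forall>x\<in>carrier V. \<forall>y\<in>carrier V. \<forall>t.
        A (((1 - t) \<odot>\<^bsub>V\<^esub> x) \<oplus>\<^bsub>V\<^esub> (t \<odot>\<^bsub>V\<^esub> y)) = ((1 - t) \<odot>\<^bsub>V\<^esub> A x) \<oplus>\<^bsub>V\<^esub> (t \<odot>\<^bsub>V\<^esub> A y))"

definition metrically_proper ::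
    "('g, 'k) monoid_scheme \<Rightarrow> 'g topology \<Rightarrow> ('v, 'm) inner_space_scheme \<Rightarrow> ('g \<Rightarrow> 'v \<Rightarrow> 'v) \<Rightarrow> bool"
  where
  "metrically_proper G T V \<alpha> \<longleftrightarrow>
     (\<forall>B. Metric_space.mbounded (carrier V) (ip_dist V) B \<longrightarrow>
        compactin T (Abstract_Topology.closure_of T {g \<in> carrier G. \<alpha> g ` B \<inter> B \<noteq> {}}))"

text \<open>Restricting the points of the Hilbert space to the type \<^typ>\<open>'g \<times> nat \<Rightarrow> real\<close> loses no
  generality: an action as below restricts to the closed affine span of an orbit, which (with a
  point of it as origin) is a Hilbert space with a dense subset of cardinality at most that of
  \<^typ>\<open>'g \<times> nat\<close>, hence isometric to a closed subspace of the square-summable functions on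
  \<^typ>\<open>'g \<times> nat\<close>.\<close>

definition a_T_menable :: "('g, 'k) monoid_scheme \<Rightarrow> 'g topology \<Rightarrow> bool" where
  "a_T_menable G T \<longleftrightarrow>
     topological_group G T \<and>
     (\<exists>(V :: ('g \<times> nat \<Rightarrow> real) inner_space) \<alpha>.
        hilbert_space V \<and>
        group_action G (carrier V) \<alpha> \<and>
        (\<forall>g\<in>carrier G. affine_isometry V (\<alpha> g)) \<and>
        continuous_map (prod_topology T (ip_topology V)) (ip_topology V) (\<lambda>(g, x). \<alpha> g x) \<and>
        metrically_proper G T V \<alpha>)"

end

theory Submission
  imports Defs "HOL-Analysis.Infinite_Sum" "HOL-Analysis.L2_Norm" "HOL-Library.Countable"
begin

text \<open>The Neretin group \<open>N\<close> acts on the set of embedded balls \<open>g[v]\<close> (\<open>g \<in> N\<close> and \<open>v\<close> a vertex, where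
  \<open>g[v] = h[w]\<close> if \<open>h\<^sup>-\<^sup>1 g\<close> maps the subtree below \<open>v\<close> isomorphically onto the one below \<open>w\<close>). It
  commensurates the set \<open>A\<close> of standard balls \<open>1[v]\<close>: the ball \<open>g[v]\<close> is nonstandard exactly for
  the finitely many \<open>v\<close> in the smallest admissible \<open>F\<close> outside of which \<open>g\<close> is a forest isomorphism,
  so \<open>gA \<triangle> A\<close> has as many elements as the minimal \<open>F\<close> and \<open>F'\<close> of \<open>g\<close> together. Bounding this
  number leaves finitely many \<open>F\<close>, \<open>F'\<close> and bijections between the roots of the complements, hence
  finitely many cosets of the compact open subgroup of tree automorphisms. Therefore the affine
  isometric action \<open>f \<mapsto> g f + 1_{gA} - 1_A\<close> on the square-summable functions is
  proper, and it is continuous because the stabilizers of \<open>A\<close> and of its points are open.\<close>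

section \<open>Square-summable functions\<close>

text \<open>An almost automorphism acts only partially on the vertices, by \<open>moves\<close>. The
  embedded balls are the globalization of this partial action: a set with a genuine action in which
  the vertices survive as the standard balls. The function \<open>1_{gA} - 1_A\<close> is the formal
  coboundary of \<open>1_A\<close>. As \<open>A\<close> is infinite, \<open>1_A\<close> is not
  square-summable, so the cocycle can be unbounded although its cocycle identity is automatic, and
  its squared norm counts \<open>gA \<triangle> A\<close>. Two facts about germs at infinity carry
  the combinatorics. Representatives of one class agree wherever both are defined, so each element
  has a single partial map with a largest domain. And an element fixing every root of the complement
  of an admissible \<open>F\<close> is a tree automorphism trivial on \<open>F\<close>; the
  continuity of conjugation and the coset count behind properness both rest on this. Since the
  topology is given by a definite description, it is built from cosets of pointwise stabilizers of
  balls and then shown to be the only candidate.\<close>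

definition sq_summable :: "('a \<Rightarrow> real) \<Rightarrow> bool" where
  "sq_summable f \<longleftrightarrow> (\<lambda>x. (f x)\<^sup>2) summable_on UNIV"

definition l2_norm :: "('a \<Rightarrow> real) \<Rightarrow> real" where
  "l2_norm f = sqrt (\<Sum>\<^sub>\<infinity>x. (f x)\<^sup>2)"

lemma l2_norm_nonneg [simp]: "0 \<le> l2_norm f"
  by (simp add: l2_norm_def infsum_nonneg)

lemma L2_set_le_l2_norm:
  assumes "sq_summable f" "finite F"
  shows "L2_set f F \<le> l2_norm f"
  using assms unfolding L2_set_def l2_norm_def sq_summable_def
  by (intro real_sqrt_le_mono finite_sum_le_infsum) auto

text \<open>Partial sums bounded by \<open>c\<close> squared bound the whole nonnegative series.
  Summability and norm bounds are thus reduced to finite sets, where Minkowski's inequality is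
  \<open>L2_set_triangle_ineq\<close>.\<close>

lemma sq_summable_l2_norm_leI:
  assumes "\<And>F. finite F \<Longrightarrow> L2_set f F \<le> c"
  shows "sq_summable f" "l2_norm f \<le> c"
proof -
  have "0 \<le> c"
    using assms[of "{}"] by simp
  have le: "(\<Sum>x\<in>F. (f x)\<^sup>2) \<le> c\<^sup>2" if "finite F" for F
    using assms[OF that] \<open>0 \<le> c\<close> unfolding L2_set_def
    by (metis real_sqrt_le_iff real_sqrt_abs abs_of_nonneg)
  show *: "sq_summable f"
    unfolding sq_summable_def
    by (rule nonneg_bdd_above_summable_on) (auto intro!: bdd_aboveI2[where M = "c\<^sup>2"] le)
  have "(\<Sum>\<^sub>\<infinity>x. (f x)\<^sup>2) \<le> c\<^sup>2"
    using * le unfolding sq_summable_def by (intro infsum_le_finite_sums) auto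
  then show "l2_norm f \<le> c"
    unfolding l2_norm_def using \<open>0 \<le> c\<close> real_le_lsqrt by blast
qed

lemma
  assumes "sq_summable f" "sq_summable g"
  shows sq_summable_add: "sq_summable (\<lambda>x. f x + g x)"
    and l2_norm_triangle: "l2_norm (\<lambda>x. f x + g x) \<le> l2_norm f + l2_norm g"
proof -
  have "L2_set (\<lambda>x. f x + g x) F \<le> l2_norm f + l2_norm g" if "finite F" for F
    using L2_set_triangle_ineq[of f g F] L2_set_le_l2_norm[OF assms(1) that]
      L2_set_le_l2_norm[OF assms(2) that] by linarith
  then show "sq_summable (\<lambda>x. f x + g x)" "l2_norm (\<lambda>x. f x + g x) \<le> l2_norm f + l2_norm g"
    by (intro sq_summable_l2_norm_leI; blast)+
qed

lemma sq_summable_cmult: "sq_summable f \<Longrightarrow> sq_summable (\<lambda>x. c * f x)"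
  unfolding sq_summable_def by (simp add: power_mult_distrib summable_on_cmult_right)

lemma sq_summable_minus [simp]: "sq_summable (\<lambda>x. - f x) \<longleftrightarrow> sq_summable f"
  by (simp add: sq_summable_def)

lemma sq_summable_diff:
  "sq_summable f \<Longrightarrow> sq_summable g \<Longrightarrow> sq_summable (\<lambda>x. f x - g x)"
  using sq_summable_add[of f "\<lambda>x. - g x"] by simp

lemma sq_summable_finite_support:
  assumes "finite {x. f x \<noteq> 0}"
  shows "sq_summable f"
proof -
  have "(\<lambda>x. (f x)\<^sup>2) summable_on {x. f x \<noteq> 0}"
    using assms by simp
  then show ?thesis
    unfolding sq_summable_def by (rule summable_on_cong_neutral[THEN iffD1, rotated -1]) auto
qed

lemma l2_norm_minus_commute: "l2_norm (\<lambda>x. f x - g x) = l2_norm (\<lambda>x. g x - f x)"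
  by (simp add: l2_norm_def power2_commute)

lemma l2_norm_eq_0_iff:
  assumes "sq_summable f"
  shows "l2_norm f = 0 \<longleftrightarrow> f = (\<lambda>x. 0)"
proof
  assume "l2_norm f = 0"
  then have "L2_set f {x} \<le> 0" for x
    using L2_set_le_l2_norm[OF assms, of "{x}"] by simp
  then show "f = (\<lambda>x. 0)" by auto
qed (simp add: l2_norm_def)

text \<open>Polarization: \<open>f g\<close> is half of \<open>(f + g)^2 - f^2 - g^2\<close>, and
  all three squares are summable.\<close>

lemma sq_summable_mult:
  assumes "sq_summable f" "sq_summable g"
  shows "(\<lambda>x. f x * g x) summable_on UNIV"
proof -
  have "(\<lambda>x. ((f x + g x)\<^sup>2 + - ((f x)\<^sup>2 + (g x)\<^sup>2)) * (1/2)) summable_on UNIV"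
    using assms sq_summable_add[OF assms] unfolding sq_summable_def
    by (intro summable_on_cmult_left summable_on_uminus[THEN iffD2] summable_on_add)
  then show ?thesis
    by (simp add: power2_sum)
qed

lemma
  assumes "bij \<sigma>"
  shows sq_summable_reindex_bij: "sq_summable (\<lambda>x. f (\<sigma> x)) \<longleftrightarrow> sq_summable f"
    and l2_norm_reindex_bij: "l2_norm (\<lambda>x. f (\<sigma> x)) = l2_norm f"
  using summable_on_reindex_bij_betw[OF assms, of "\<lambda>x. (f x)\<^sup>2"]
    infsum_reindex_bij_betw[OF assms, of "\<lambda>x. (f x)\<^sup>2"]
  by (simp_all add: sq_summable_def l2_norm_def)

text \<open>Take \<open>F\<close> whose partial sum of squares is within \<open>(e/2)^2\<close> of
  the total. The half leaves room for the strict inequality, since the finite-set criterion only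
  yields a weak one. In \<open>continuous_affine\<close> this leaves finitely many points to be
  stabilized.\<close>

lemma l2_norm_tail:
  assumes "sq_summable f" "0 < e"
  obtains F where "finite F" "l2_norm (\<lambda>x. if x \<in> F then 0 else f x) < e"
proof -
  have "0 < (e/2)\<^sup>2" using assms(2) by simp
  let ?s = "\<Sum>\<^sub>\<infinity>x. (f x)\<^sup>2"
  have sum: "(\<lambda>x. (f x)\<^sup>2) summable_on UNIV"
    using assms(1) by (simp add: sq_summable_def)
  have "\<exists>F. finite F \<and> sum (\<lambda>x. (f x)\<^sup>2) F > ?s - (e/2)\<^sup>2"
  proof (rule ccontr)
    assume "\<not> ?thesis"
    then have "?s \<le> ?s - (e/2)\<^sup>2"
      by (intro infsum_le_finite_sums[OF sum]) (auto simp: not_less)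
    then show False using \<open>0 < (e/2)\<^sup>2\<close> by linarith
  qed
  then obtain F where F: "finite F" "sum (\<lambda>x. (f x)\<^sup>2) F > ?s - (e/2)\<^sup>2" by blast
  have "L2_set (\<lambda>x. if x \<in> F then 0 else f x) H \<le> e/2" if "finite H" for H
  proof -
    have "(\<Sum>x\<in>H. (if x \<in> F then 0 else f x)\<^sup>2) = (\<Sum>x\<in>H - F. (f x)\<^sup>2)"
      using that by (intro sum.mono_neutral_cong_right) auto
    also have "\<dots> = (\<Sum>x\<in>H \<union> F. (f x)\<^sup>2) - (\<Sum>x\<in>F. (f x)\<^sup>2)"
      using that F(1) sum.union_disjoint[of "H - F" F "\<lambda>x. (f x)\<^sup>2"]
      by (simp add: Int_commute Un_Diff_cancel2)
    also have "\<dots> \<le> ?s - (\<Sum>x\<in>F. (f x)\<^sup>2)"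
      using finite_sum_le_infsum[OF sum, of "H \<union> F"] that F(1) by simp
    also have "\<dots> \<le> (e/2)\<^sup>2" using F(2) by simp
    finally show ?thesis
      unfolding L2_set_def using assms(2) by (intro real_le_lsqrt) auto
  qed
  then have "l2_norm (\<lambda>x. if x \<in> F then 0 else f x) \<le> e/2"
    by (rule sq_summable_l2_norm_leI)
  then show ?thesis
    using F(1) assms(2) that by fastforce
qed

text \<open>The limit is taken pointwise. On each finite set the Cauchy estimate survives letting
  one index tend to infinity, and the finite-set criterion turns these bounds into a norm
  bound.\<close>

lemma l2_complete:
  fixes f :: "nat \<Rightarrow> 'a \<Rightarrow> real"
  assumes f: "\<And>n. sq_summable (f n)"
    and cauchy: "\<And>e. 0 < e \<Longrightarrow> \<exists>N. \<forall>m\<ge>N. \<forall>n\<ge>N. l2_norm (\<lambda>x. f m x - f n x) < e"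
  obtains g where "sq_summable g"
    "\<And>e. 0 < e \<Longrightarrow> \<exists>N. \<forall>n\<ge>N. l2_norm (\<lambda>x. f n x - g x) \<le> e"
proof -
  have "Cauchy (\<lambda>n. f n x)" for x
    unfolding Cauchy_def
  proof (intro allI impI)
    fix e :: real assume "0 < e"
    then obtain N where N: "\<forall>m\<ge>N. \<forall>n\<ge>N. l2_norm (\<lambda>x. f m x - f n x) < e"
      using cauchy by blast
    have "dist (f m x) (f n x) < e" if "m \<ge> N" "n \<ge> N" for m n
      using L2_set_le_l2_norm[OF sq_summable_diff[OF f f], of "{x}" m n] N that
      by (fastforce simp: dist_real_def)
    then show "\<exists>N. \<forall>m\<ge>N. \<forall>n\<ge>N. dist (f m x) (f n x) < e" by blast
  qed
  then have "\<forall>x. \<exists>l. (\<lambda>n. f n x) \<longlonglongrightarrow> l"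
    by (simp add: Cauchy_convergent_iff convergent_def)
  then obtain g where g: "\<And>x. (\<lambda>n. f n x) \<longlonglongrightarrow> g x" by metis
  have le: "sq_summable (\<lambda>x. f n x - g x) \<and> l2_norm (\<lambda>x. f n x - g x) \<le> e"
    if N: "\<forall>m\<ge>N. \<forall>n\<ge>N. l2_norm (\<lambda>x. f m x - f n x) < e" and "n \<ge> N" for e N n
  proof -
    have "L2_set (\<lambda>x. f n x - g x) F \<le> e" if "finite F" for F
    proof (rule LIMSEQ_le_const2)
      show "(\<lambda>m. L2_set (\<lambda>x. f n x - f m x) F) \<longlonglongrightarrow> L2_set (\<lambda>x. f n x - g x) F"
        unfolding L2_set_def by (intro tendsto_intros g)
      have "L2_set (\<lambda>x. f n x - f m x) F \<le> e" if "m \<ge> N" for m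
        using L2_set_le_l2_norm[OF sq_summable_diff[OF f f] \<open>finite F\<close>, of n m] N \<open>n \<ge> N\<close> that
        by fastforce
      then show "\<exists>N. \<forall>m\<ge>N. L2_set (\<lambda>x. f n x - f m x) F \<le> e" by blast
    qed
    then show ?thesis by (intro conjI sq_summable_l2_norm_leI)
  qed
  obtain N where N: "\<forall>m\<ge>N. \<forall>n\<ge>N. l2_norm (\<lambda>x. f m x - f n x) < 1"
    using cauchy[of 1] by auto
  \<comment> \<open>The limit is a member of the sequence minus a difference already known to be
    square-summable.\<close>
  have "sq_summable (\<lambda>x. f N x - (f N x - g x))"
    by (rule sq_summable_diff[OF f conjunct1[OF le[OF N order_refl]]])
  then have "sq_summable g" by simp
  moreover have "\<exists>N. \<forall>n\<ge>N. l2_norm (\<lambda>x. f n x - g x) \<le> e" if e: "0 < e" for e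
  proof -
    obtain N where N: "\<forall>m\<ge>N. \<forall>n\<ge>N. l2_norm (\<lambda>x. f m x - f n x) < e"
      using cauchy[OF e] by (elim exE)
    show ?thesis
      using le[OF N] by (intro exI[of _ N] allI impI) simp
  qed
  ultimately show ?thesis by (rule that)
qed

section \<open>The Hilbert space of square-summable functions\<close>

definition ell2 :: "('a \<Rightarrow> real) inner_space" where
  "ell2 = \<lparr>carrier = {f. sq_summable f}, monoid.mult = undefined, one = undefined,
     zero = (\<lambda>x. 0), add = (\<lambda>f g x. f x + g x), smult = (\<lambda>c f x. c * f x),
     ip = (\<lambda>f g. \<Sum>\<^sub>\<infinity>x. f x * g x)\<rparr>"

lemma ell2_simps [simp]:
  "f \<in> carrier ell2 \<longleftrightarrow> sq_summable f" "zero ell2 = (\<lambda>x. 0)"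
  "add ell2 f g = (\<lambda>x. f x + g x)" "smult ell2 c f = (\<lambda>x. c * f x)"
  by (simp_all add: ell2_def)

lemma real_ring_simps [simp]:
  "carrier real_ring = UNIV" "zero real_ring = 0" "one real_ring = 1"
  "add real_ring x y = x + y" "monoid.mult real_ring x y = x * y"
  by (simp_all add: real_ring_def)

lemma cring_real_ring: "cring real_ring"
proof (rule cringI)
  show "abelian_group real_ring"
    by (rule abelian_groupI) (auto intro: exI[of _ "- x" for x])
  show "comm_monoid real_ring"
    by (rule comm_monoidI) auto
qed (auto simp: distrib_right)

lemma abelian_group_ell2: "abelian_group (ell2 :: ('a \<Rightarrow> real) inner_space)"
proof (rule abelian_groupI)
  show "\<exists>y\<in>carrier ell2. y \<oplus>\<^bsub>ell2\<^esub> x = \<zero>\<^bsub>ell2\<^esub>" if "x \<in> carrier ell2" for x :: "'a \<Rightarrow> real"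
    using that by (intro bexI[of _ "\<lambda>z. - x z"]) auto
qed (auto simp: sq_summable_add sq_summable_finite_support)

lemma module_ell2: "Module.module real_ring (ell2 :: ('a \<Rightarrow> real) inner_space)"
  by (rule moduleI) (auto simp: cring_real_ring abelian_group_ell2 sq_summable_cmult algebra_simps)

lemma minus_ell2:
  assumes "sq_summable f" "sq_summable g"
  shows "f \<ominus>\<^bsub>ell2\<^esub> g = (\<lambda>x. f x - g x)"
proof -
  have "\<ominus>\<^bsub>ell2\<^esub> g = (\<lambda>x. - g x)"
    using assms by (intro abelian_group.minus_equality[OF abelian_group_ell2]) auto
  then show ?thesis by (simp add: a_minus_def)
qed

lemma ip_dist_ell2:
  "ip_dist ell2 f g =
    (if sq_summable f \<and> sq_summable g then l2_norm (\<lambda>x. f x - g x) else 0)"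
  by (simp add: ip_dist_def minus_ell2) (simp add: ell2_def l2_norm_def power2_eq_square)

lemma Metric_space_ell2: "Metric_space (carrier ell2) (ip_dist ell2)"
proof
  fix f g h :: "'a \<Rightarrow> real"
  show "0 \<le> ip_dist ell2 f g" by (simp add: ip_dist_ell2)
  show "ip_dist ell2 f g = ip_dist ell2 g f"
    using l2_norm_minus_commute[of f g] by (simp add: ip_dist_ell2)
  show "f \<in> carrier ell2 \<Longrightarrow> g \<in> carrier ell2 \<Longrightarrow> ip_dist ell2 f g = 0 \<longleftrightarrow> f = g"
    by (auto simp: ip_dist_ell2 l2_norm_eq_0_iff sq_summable_diff fun_eq_iff)
  show "f \<in> carrier ell2 \<Longrightarrow> g \<in> carrier ell2 \<Longrightarrow> h \<in> carrier ell2 \<Longrightarrow>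
      ip_dist ell2 f h \<le> ip_dist ell2 f g + ip_dist ell2 g h"
    using l2_norm_triangle[of "\<lambda>x. f x - g x" "\<lambda>x. g x - h x"]
    by (simp add: ip_dist_ell2 sq_summable_diff)
qed

lemma mcomplete_ell2:
  "Metric_space.mcomplete (carrier ell2) (ip_dist (ell2 :: ('a \<Rightarrow> real) inner_space))"
proof -
  interpret ell2: Metric_space "carrier ell2" "ip_dist (ell2 :: ('a \<Rightarrow> real) inner_space)"
    by (rule Metric_space_ell2)
  show ?thesis
    unfolding ell2.mcomplete_def
  proof (intro allI impI)
    fix f :: "nat \<Rightarrow> 'a \<Rightarrow> real"
    assume f: "ell2.MCauchy f"
    then have sq: "sq_summable (f n)" for n
      unfolding ell2.MCauchy_def by (metis ell2_simps(1) range_subsetD)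
    from f have "\<exists>N. \<forall>m\<ge>N. \<forall>n\<ge>N. l2_norm (\<lambda>x. f m x - f n x) < e" if "0 < e" for e
      using that by (fastforce simp: ell2.MCauchy_def ip_dist_ell2 sq)
    then obtain g where g: "sq_summable g"
      "\<And>e. 0 < e \<Longrightarrow> \<exists>N. \<forall>n\<ge>N. l2_norm (\<lambda>x. f n x - g x) \<le> e"
      using l2_complete[of f] sq by metis
    have "\<exists>N. \<forall>n\<ge>N. f n \<in> carrier ell2 \<and> ip_dist ell2 (f n) g < e" if "0 < e" for e
    proof -
      obtain N where N: "\<forall>n\<ge>N. l2_norm (\<lambda>x. f n x - g x) \<le> e / 2"
        using g(2)[of "e / 2"] \<open>0 < e\<close> half_gt_zero by blast
      have "l2_norm (\<lambda>x. f n x - g x) < e" if "n \<ge> N" for n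
        using spec[OF N, of n] that \<open>0 < e\<close> by linarith
      then show ?thesis
        using sq g(1) by (auto simp: ip_dist_ell2)
    qed
    then show "\<exists>g. limitin ell2.mtopology f g sequentially"
      using g(1) by (auto simp: ell2.limit_metric_sequentially)
  qed
qed

lemma hilbert_space_ell2: "hilbert_space (ell2 :: ('a \<Rightarrow> real) inner_space)"
proof -
  have ip: "ip ell2 f g = (\<Sum>\<^sub>\<infinity>x. f x * g x)" for f g :: "'a \<Rightarrow> real"
    by (simp add: ell2_def)
  show ?thesis
    unfolding hilbert_space_def
  proof (intro conjI ballI allI impI)
    fix f g h :: "'a \<Rightarrow> real" and c :: real
    show "f \<in> carrier ell2 \<Longrightarrow> g \<in> carrier ell2 \<Longrightarrow> ip ell2 f g = ip ell2 g f"
      by (simp add: ip mult.commute)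
    show "f \<in> carrier ell2 \<Longrightarrow> g \<in> carrier ell2 \<Longrightarrow> h \<in> carrier ell2 \<Longrightarrow>
        ip ell2 (f \<oplus>\<^bsub>ell2\<^esub> g) h = ip ell2 f h + ip ell2 g h"
      by (simp add: ip distrib_right infsum_add sq_summable_mult)
    show "f \<in> carrier ell2 \<Longrightarrow> g \<in> carrier ell2 \<Longrightarrow> ip ell2 (c \<odot>\<^bsub>ell2\<^esub> f) g = c * ip ell2 f g"
      by (simp add: ip mult.assoc infsum_cmult_right')
    show "f \<in> carrier ell2 \<Longrightarrow> 0 \<le> ip ell2 f f"
      by (simp add: ip infsum_nonneg)
    show "f = \<zero>\<^bsub>ell2\<^esub>" if "f \<in> carrier ell2" "ip ell2 f f = 0"
      using that l2_norm_eq_0_iff[of f] by (simp add: ip l2_norm_def power2_eq_square)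
  qed (simp_all add: module_ell2 mcomplete_ell2)
qed

section \<open>Commensurating actions\<close>

locale commensurating_action =
  fixes G :: "('g, 'k) monoid_scheme" (structure) and T :: "'g topology"
    and act :: "'g \<Rightarrow> 'x \<Rightarrow> 'x" and A :: "'x set"
  assumes top_group: "topological_group G T"
    and act_one: "act \<one> x = x"
    and act_mult: "g \<in> carrier G \<Longrightarrow> h \<in> carrier G \<Longrightarrow> act (g \<otimes> h) x = act g (act h x)"
    and commensurated: "g \<in> carrier G \<Longrightarrow> finite (sym_diff (act g ` A) A)"
    and stabilizer_point: "\<exists>U. openin T U \<and> \<one> \<in> U \<and> (\<forall>g\<in>U. act g x = x)"
    and stabilizer_set: "\<exists>U. openin T U \<and> \<one> \<in> U \<and> (\<forall>g\<in>U. act g ` A = A)"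
    and proper: "\<exists>C. compactin T C \<and> closedin T C \<and>
      {g \<in> carrier G. card (sym_diff (act g ` A) A) \<le> n} \<subseteq> C"
begin

sublocale group G
  using top_group by (simp add: topological_group_def)

lemma topspace_T: "topspace T = carrier G"
  using top_group by (simp add: topological_group_def)

lemma act_inv:
  assumes "g \<in> carrier G"
  shows "act (inv g) (act g x) = x" "act g (act (inv g) x) = x"
  using assms act_mult[of "inv g" g x] act_mult[of g "inv g" x] by (simp_all add: act_one)

lemma bij_act: "g \<in> carrier G \<Longrightarrow> bij (act g)"
  by (metis act_inv bijI')

lemma mem_act_image: "g \<in> carrier G \<Longrightarrow> x \<in> act g ` A \<longleftrightarrow> act (inv g) x \<in> A"
  by (metis act_inv image_iff)

definition cocycle :: "'g \<Rightarrow> 'x \<Rightarrow> real" where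
  "cocycle g x = indicator A (act (inv g) x) - indicator A x"

definition affine_act :: "'g \<Rightarrow> ('x \<Rightarrow> real) \<Rightarrow> 'x \<Rightarrow> real" where
  "affine_act g f x = f (act (inv g) x) + cocycle g x"

lemma support_cocycle:
  "g \<in> carrier G \<Longrightarrow> {x. cocycle g x \<noteq> 0} = sym_diff (act g ` A) A"
  unfolding cocycle_def set_eq_iff Un_iff Diff_iff mem_Collect_eq
  by (simp add: mem_act_image indicator_def)

lemma sq_summable_affine:
  assumes "g \<in> carrier G" "sq_summable f"
  shows "sq_summable (affine_act g f)"
proof -
  have "sq_summable (cocycle g)"
    using assms commensurated by (simp add: sq_summable_finite_support support_cocycle)
  moreover have "sq_summable (\<lambda>x. f (act (inv g) x))"
    using assms by (simp add: sq_summable_reindex_bij bij_act)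
  ultimately show ?thesis
    unfolding affine_act_def by (simp add: sq_summable_add)
qed

lemma affine_one: "affine_act \<one> f = f"
  by (simp add: affine_act_def cocycle_def act_one fun_eq_iff)

lemma affine_mult:
  "g \<in> carrier G \<Longrightarrow> h \<in> carrier G \<Longrightarrow> affine_act (g \<otimes> h) f = affine_act g (affine_act h f)"
  by (simp add: affine_act_def cocycle_def act_mult inv_mult_group fun_eq_iff)

lemma l2_norm_affine_diff:
  "g \<in> carrier G \<Longrightarrow> l2_norm (\<lambda>x. affine_act g f x - affine_act g f' x) = l2_norm (\<lambda>x. f x - f' x)"
  using l2_norm_reindex_bij[of "act (inv g)" "\<lambda>x. f x - f' x"]
  by (simp add: affine_act_def bij_act)

text \<open>Elements of \<open>BijGroup\<close> are extensional, hence the \<open>restrict\<close>.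
  Bijectivity comes from the inverse map \<open>affine_act (inv g)\<close>.\<close>

lemma group_action_affine: "group_action G (carrier ell2) (\<lambda>g. restrict (affine_act g) (carrier ell2))"
proof -
  have bij: "restrict (affine_act g) (carrier ell2) \<in> Bij (carrier ell2)" if g: "g \<in> carrier G" for g
  proof -
    have "bij_betw (restrict (affine_act g) (carrier ell2)) (carrier ell2) (carrier ell2)"
      using g by (intro bij_betw_byWitness[where f' = "affine_act (inv g)"])
        (auto simp: sq_summable_affine affine_one simp flip: affine_mult)
    then show ?thesis by (simp add: Bij_def)
  qed
  have "group_hom G (BijGroup (carrier ell2)) (\<lambda>g. restrict (affine_act g) (carrier ell2))"
  proof (intro group_hom.intro group_hom_axioms.intro homI)
    show "group G" ..
    show "group (BijGroup (carrier (ell2 :: ('x \<Rightarrow> real) inner_space)))"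
      by (rule group_BijGroup)
    show "restrict (affine_act g) (carrier ell2) \<in> carrier (BijGroup (carrier ell2))"
      if "g \<in> carrier G" for g
      using bij that by (simp add: BijGroup_def)
    show "restrict (affine_act (g \<otimes> h)) (carrier ell2) =
        restrict (affine_act g) (carrier ell2) \<otimes>\<^bsub>BijGroup (carrier ell2)\<^esub> restrict (affine_act h) (carrier ell2)"
      if "g \<in> carrier G" "h \<in> carrier G" for g h
      using bij[OF that(1)] bij[OF that(2)] that
      by (auto simp: BijGroup_def compose_def affine_mult sq_summable_affine fun_eq_iff restrict_def)
  qed
  then show ?thesis by (rule group_action.intro)
qed

lemma affine_isometry_affine:
  assumes g: "g \<in> carrier G"
  shows "affine_isometry ell2 (restrict (affine_act g) (carrier ell2))"
  unfolding affine_isometry_def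
proof (intro conjI ballI allI)
  show "bij_betw (restrict (affine_act g) (carrier ell2)) (carrier ell2) (carrier ell2)"
    using g by (intro bij_betw_byWitness[where f' = "affine_act (inv g)"])
      (auto simp: sq_summable_affine affine_one simp flip: affine_mult)
  fix f f' :: "'x \<Rightarrow> real" and t :: real
  assume "f \<in> carrier ell2" "f' \<in> carrier ell2"
  then have f: "sq_summable f" "sq_summable f'" by auto
  then show "ip_dist ell2 (restrict (affine_act g) (carrier ell2) f) (restrict (affine_act g) (carrier ell2) f') =
      ip_dist ell2 f f'"
    using g by (simp add: ip_dist_ell2 sq_summable_affine l2_norm_affine_diff)
  show "restrict (affine_act g) (carrier ell2) ((1 - t) \<odot>\<^bsub>ell2\<^esub> f \<oplus>\<^bsub>ell2\<^esub> t \<odot>\<^bsub>ell2\<^esub> f') =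
      (1 - t) \<odot>\<^bsub>ell2\<^esub> restrict (affine_act g) (carrier ell2) f \<oplus>\<^bsub>ell2\<^esub>
      t \<odot>\<^bsub>ell2\<^esub> restrict (affine_act g) (carrier ell2) f'"
    using f sq_summable_add[OF sq_summable_cmult[OF f(1), of "1 - t"] sq_summable_cmult[OF f(2), of t]]
    by (simp add: affine_act_def fun_eq_iff) (simp add: algebra_simps)
qed

lemma openin_left_translate:
  assumes "openin T U" "g \<in> carrier G"
  shows "openin T {h \<in> carrier G. inv g \<otimes> h \<in> U}"
proof -
  have "continuous_map T (prod_topology T T) (\<lambda>h. (inv g, h))"
    using assms(2) by (intro continuous_map_pairedI) (auto simp: topspace_T)
  moreover have "continuous_map (prod_topology T T) T (\<lambda>(x, y). x \<otimes> y)"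
    using top_group by (simp add: topological_group_def)
  ultimately have "continuous_map T T ((\<lambda>(x, y). x \<otimes> y) \<circ> (\<lambda>h. (inv g, h)))"
    by (rule continuous_map_compose)
  then show ?thesis
    using openin_continuous_map_preimage[OF _ assms(1)] by (force simp: o_def topspace_T)
qed

text \<open>Since \<open>affine_act g0\<close> is an isometry, continuity at \<open>(g0, f0)\<close>
  reduces to moving \<open>f0\<close> little by \<open>h = inv g0 \<otimes> g\<close> near the
  identity. If \<open>h\<close> stabilizes \<open>A\<close>, its cocycle vanishes; if it also fixes
  the points carrying most of \<open>f0\<close>, only a small tail is moved.\<close>

lemma continuous_affine:
  "continuous_map (prod_topology T (ip_topology ell2)) (ip_topology ell2)
    (\<lambda>(g, f). restrict (affine_act g) (carrier ell2) f)"
proof -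
  interpret ell2: Metric_space "carrier ell2" "ip_dist (ell2 :: ('x \<Rightarrow> real) inner_space)"
    by (rule Metric_space_ell2)
  show ?thesis
    unfolding ip_topology_def ell2.continuous_map_to_metric
  proof (intro ballI allI impI)
    fix p :: "'g \<times> ('x \<Rightarrow> real)" and e :: real
    assume "p \<in> topspace (prod_topology T ell2.mtopology)" "0 < e"
    then obtain g0 f0 where p: "p = (g0, f0)" and g0: "g0 \<in> carrier G" and f0: "sq_summable f0"
      by (auto simp: topspace_T)
    \<comment> \<open>The tail enters twice, once as itself and once translated, and
      \<open>f0 - f\<close> a third time, so quarters of \<open>e\<close> suffice.\<close>
    obtain F where F: "finite F" "l2_norm (\<lambda>x. if x \<in> F then 0 else f0 x) < e / 4"
      using l2_norm_tail[OF f0, of "e / 4"] \<open>0 < e\<close> by auto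
    define f1 where "f1 x = (if x \<in> F then 0 else f0 x)" for x
    define f2 where "f2 x = (if x \<in> F then f0 x else 0)" for x
    have "sq_summable f2"
      using F(1) by (intro sq_summable_finite_support) (auto simp: f2_def elim: finite_subset[rotated])
    moreover have "f1 = (\<lambda>x. f0 x - f2 x)"
      by (auto simp: f1_def f2_def)
    ultimately have f1: "sq_summable f1"
      using f0 by (simp add: sq_summable_diff)
    obtain UA where UA: "openin T UA" "\<one> \<in> UA" "\<forall>g\<in>UA. act g ` A = A"
      using stabilizer_set by blast
    obtain U where U: "\<And>x. openin T (U x)" "\<And>x. \<one> \<in> U x" "\<And>x g. g \<in> U x \<Longrightarrow> act g x = x"
      using stabilizer_point by metis
    define W where "W = \<Inter> (insert UA (U ` F))"
    have "openin T W"
      unfolding W_def using UA(1) U(1) F(1) by (intro openin_Inter) auto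
    moreover have "\<one> \<in> W"
      using UA(2) U(2) by (simp add: W_def)
    ultimately have W: "openin T W" "\<one> \<in> W" .
    define N where "N = {h \<in> carrier G. inv g0 \<otimes> h \<in> W}"
    have "openin (prod_topology T ell2.mtopology) (N \<times> ell2.mball f0 (e / 4))"
      by (simp add: openin_prod_Times_iff N_def openin_left_translate W g0)
    moreover have "p \<in> N \<times> ell2.mball f0 (e / 4)"
      using g0 f0 \<open>0 < e\<close> W by (simp add: p N_def)
    moreover have "(case q of (g, f) \<Rightarrow> restrict (affine_act g) (carrier ell2) f) \<in>
        ell2.mball (case p of (g, f) \<Rightarrow> restrict (affine_act g) (carrier ell2) f) e"
      if "q \<in> N \<times> ell2.mball f0 (e / 4)" for q
    proof -
      obtain g f where q: "q = (g, f)" by (cases q)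
      have g: "g \<in> carrier G" "inv g0 \<otimes> g \<in> W" and "f \<in> ell2.mball f0 (e / 4)"
        using that by (simp_all add: q N_def)
      then have f: "sq_summable f" "l2_norm (\<lambda>x. f0 x - f x) < e / 4"
        unfolding ell2.in_mball by (simp_all add: ip_dist_ell2 split: if_splits)
      define h where "h = inv g0 \<otimes> g"
      have h: "h \<in> carrier G" and gh: "g = g0 \<otimes> h"
        using g g0 by (simp_all add: h_def flip: m_assoc)
      have hA: "act h ` A = A" and hF: "\<And>x. x \<in> F \<Longrightarrow> act h x = x"
        using g(2) UA(3) U(3) by (auto simp: h_def W_def)
      have cocycle_h: "cocycle h x = 0" for x
        using support_cocycle[OF h] hA by auto
      \<comment> \<open>\<open>h\<close> fixes \<open>F\<close> pointwise and hence preserves its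
        complement, so the part \<open>f2\<close> of \<open>f0\<close> supported on \<open>F\<close>
        cancels.\<close>
      have "f0 x - affine_act h f0 x = f1 x - f1 (act (inv h) x)" for x
      proof -
        have "act (inv h) x \<in> F \<longleftrightarrow> x \<in> F"
          using act_inv[OF h] hF by metis
        moreover have "act (inv h) x = x" if "x \<in> F"
          using act_inv[OF h] hF that by metis
        ultimately show ?thesis
          by (auto simp: affine_act_def cocycle_h f1_def)
      qed
      then have "l2_norm (\<lambda>x. f0 x - affine_act h f0 x) = l2_norm (\<lambda>x. f1 x + - f1 (act (inv h) x))"
        by simp
      also have "\<dots> \<le> l2_norm f1 + l2_norm (\<lambda>x. - f1 (act (inv h) x))"
        using f1 h by (intro l2_norm_triangle) (simp_all add: sq_summable_reindex_bij bij_act)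
      also have "l2_norm (\<lambda>x. - f1 (act (inv h) x)) = l2_norm (\<lambda>x. - f1 x)"
        using h l2_norm_reindex_bij[of "act (inv h)" "\<lambda>x. - f1 x"] by (simp add: bij_act)
      also have "\<dots> = l2_norm f1"
        by (simp add: l2_norm_def)
      finally have 1: "l2_norm (\<lambda>x. f0 x - affine_act h f0 x) < e / 2"
        using F(2)[folded f1_def] by simp
      have "l2_norm (\<lambda>x. affine_act g0 f0 x - affine_act g f x) = l2_norm (\<lambda>x. f0 x - affine_act h f x)"
        using g0 h by (simp add: gh affine_mult l2_norm_affine_diff)
      also have "\<dots> = l2_norm (\<lambda>x. (f0 x - affine_act h f0 x) + (affine_act h f0 x - affine_act h f x))"
        by simp
      also have "\<dots> \<le> l2_norm (\<lambda>x. f0 x - affine_act h f0 x) + l2_norm (\<lambda>x. affine_act h f0 x - affine_act h f x)"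
        using f f0 h by (intro l2_norm_triangle sq_summable_diff sq_summable_affine) auto
      also have "\<dots> < e"
        using 1 f(2) h \<open>0 < e\<close> by (simp add: l2_norm_affine_diff)
      finally show ?thesis
        using g g0 f f0 by (simp add: p q ip_dist_ell2 sq_summable_affine)
    qed
    ultimately show "\<exists>U. openin (prod_topology T ell2.mtopology) U \<and> p \<in> U \<and>
        (\<forall>q\<in>U. (case q of (g, f) \<Rightarrow> restrict (affine_act g) (carrier ell2) f) \<in>
          ell2.mball (case p of (g, f) \<Rightarrow> restrict (affine_act g) (carrier ell2) f) e)"
      by blast
  qed
qed

text \<open>The cocycle takes only the values -1, 0 and 1, so its sum of squares counts its support.
  This converts a metric bound into a bound on the symmetric difference.\<close>

lemma l2_norm_cocycle:
  assumes "g \<in> carrier G"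
  shows "l2_norm (cocycle g) = sqrt (card (sym_diff (act g ` A) A))"
proof -
  let ?S = "sym_diff (act g ` A) A"
  have sq: "(cocycle g x)\<^sup>2 = (if x \<in> ?S then 1 else 0)" for x
    unfolding Un_iff Diff_iff mem_act_image[OF assms]
    by (cases "act (inv g) x \<in> A"; cases "x \<in> A") (simp_all add: cocycle_def)
  have "(\<Sum>\<^sub>\<infinity>x. (cocycle g x)\<^sup>2) = (\<Sum>\<^sub>\<infinity>x\<in>?S. 1)"
    unfolding sq by (rule infsum_cong_neutral) simp_all
  also have "\<dots> = card ?S"
    using commensurated[OF assms] by (simp add: infsum_finite)
  finally show ?thesis by (simp add: l2_norm_def)
qed

text \<open>If \<open>g\<close> sends a point of a bounded set back into that set, it displaces
  every fixed vector by a bounded amount, in particular the zero function, whose displacement is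
  \<open>cocycle g\<close>.\<close>

lemma metrically_proper_affine:
  "metrically_proper G T ell2 (\<lambda>g. restrict (affine_act g) (carrier ell2))"
proof -
  interpret ell2: Metric_space "carrier ell2" "ip_dist (ell2 :: ('x \<Rightarrow> real) inner_space)"
    by (rule Metric_space_ell2)
  show ?thesis
    unfolding metrically_proper_def
  proof (intro allI impI)
    fix B assume "ell2.mbounded B"
    then obtain f0 R where B: "B \<subseteq> ell2.mcball f0 R"
      by (auto simp: ell2.mbounded_def)
    let ?S = "{g \<in> carrier G. restrict (affine_act g) (carrier ell2) ` B \<inter> B \<noteq> {}}"
    \<comment> \<open>The cocycle is the sum of \<open>g 0 - g f0\<close>,
      \<open>g f0 - g f\<close>, \<open>g f - f0\<close> and \<open>f0\<close>. By isometry the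
      first and last have norm \<open>l2_norm f0\<close>; the middle two have norm at most
      \<open>R\<close>.\<close>
    define c where "c = 2 * R + 2 * l2_norm f0"
    have "card (sym_diff (act g ` A) A) \<le> nat \<lceil>c\<^sup>2\<rceil>" if g: "g \<in> ?S" for g
    proof -
      from g obtain f where gc: "g \<in> carrier G" and fB: "f \<in> B" and gf: "restrict (affine_act g) (carrier ell2) f \<in> B"
        by blast
      have f: "sq_summable f" "sq_summable f0" "l2_norm (\<lambda>x. f0 x - f x) \<le> R"
        "l2_norm (\<lambda>x. f0 x - affine_act g f x) \<le> R"
        using B fB gf by (auto simp: ip_dist_ell2 sq_summable_affine[OF gc] restrict_def split: if_splits)
      have 0: "sq_summable (\<lambda>x::'x. 0::real)"
        by (simp add: sq_summable_finite_support)
      have f0': "sq_summable (\<lambda>x. f0 x - affine_act g f0 x)"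
        using f gc by (intro sq_summable_diff sq_summable_affine) auto
      have b: "affine_act g (\<lambda>x. 0) = cocycle g"
        by (simp add: affine_act_def fun_eq_iff)
      have "cocycle g = (\<lambda>x. (affine_act g (\<lambda>x. 0) x - affine_act g f0 x) +
          ((affine_act g f0 x - affine_act g f x) + ((affine_act g f x - f0 x) + f0 x)))"
        by (simp add: b)
      then have "l2_norm (cocycle g) = l2_norm (\<lambda>x. (affine_act g (\<lambda>x. 0) x - affine_act g f0 x) +
          ((affine_act g f0 x - affine_act g f x) + ((affine_act g f x - f0 x) + f0 x)))"
        by (rule arg_cong)
      also have "\<dots> \<le> l2_norm (\<lambda>x. affine_act g (\<lambda>x. 0) x - affine_act g f0 x) +
         l2_norm (\<lambda>x. (affine_act g f0 x - affine_act g f x) + ((affine_act g f x - f0 x) + f0 x))"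
        using f gc 0 by (intro l2_norm_triangle sq_summable_diff sq_summable_add sq_summable_affine) auto
      also have "l2_norm (\<lambda>x. (affine_act g f0 x - affine_act g f x) + ((affine_act g f x - f0 x) + f0 x)) \<le>
         l2_norm (\<lambda>x. affine_act g f0 x - affine_act g f x) + l2_norm (\<lambda>x. (affine_act g f x - f0 x) + f0 x)"
        using f gc by (intro l2_norm_triangle sq_summable_diff sq_summable_add sq_summable_affine) auto
      also have "l2_norm (\<lambda>x. (affine_act g f x - f0 x) + f0 x) \<le>
          l2_norm (\<lambda>x. affine_act g f x - f0 x) + l2_norm f0"
        using f gc by (intro l2_norm_triangle sq_summable_diff sq_summable_add sq_summable_affine) auto
      also have "l2_norm (\<lambda>x. affine_act g (\<lambda>x. 0) x - affine_act g f0 x) = l2_norm f0"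
        using l2_norm_affine_diff[OF gc, of "\<lambda>x. 0" f0] l2_norm_minus_commute[of f0 "\<lambda>x. 0"] by simp
      finally have "l2_norm (cocycle g) \<le> c"
        using f l2_norm_affine_diff[OF gc, of f0 f] l2_norm_minus_commute[of f0 "affine_act g f"]
        by (simp add: c_def)
      then have "sqrt (card (sym_diff (act g ` A) A)) \<le> c"
        by (simp add: l2_norm_cocycle gc)
      then have "card (sym_diff (act g ` A) A) \<le> c\<^sup>2"
        by (rule sqrt_le_D)
      then show ?thesis by linarith
    qed
    then have "?S \<subseteq> {g \<in> carrier G. card (sym_diff (act g ` A) A) \<le> nat \<lceil>c\<^sup>2\<rceil>}"
      by blast
    moreover obtain C where C: "compactin T C" "closedin T C"
      "{g \<in> carrier G. card (sym_diff (act g ` A) A) \<le> nat \<lceil>c\<^sup>2\<rceil>} \<subseteq> C"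
      using proper by blast
    ultimately have "T closure_of ?S \<subseteq> C"
      by (intro closure_of_minimal) auto
    then show "compactin T (T closure_of ?S)"
      using C(1) closed_compactin closedin_closure_of by blast
  qed
qed

end

lemma commensurating_action_imp_a_T_menable:
  fixes G :: "('g, 'k) monoid_scheme" and act :: "'g \<Rightarrow> 'g \<times> nat \<Rightarrow> 'g \<times> nat"
  assumes "commensurating_action G T act A"
  shows "a_T_menable G T"
proof -
  interpret commensurating_action G T act A by (fact assms)
  show ?thesis
    unfolding a_T_menable_def
    using top_group hilbert_space_ell2 group_action_affine affine_isometry_affine
      continuous_affine metrically_proper_affine
    by (intro conjI exI[of _ ell2] exI[of _ "\<lambda>g. restrict (affine_act g) (carrier ell2)"] ballI)
qed

section \<open>The tree\<close>

locale tree_params =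
  fixes d r :: nat
  assumes d_pos: "0 < d" and r_pos: "0 < r"
begin

abbreviation V :: "nat list set" where "V \<equiv> tree_verts d r"
abbreviation adm :: "nat list set \<Rightarrow> bool" where "adm \<equiv> admissible d r"
abbreviation co :: "nat list set \<Rightarrow> nat list set" where "co \<equiv> co_verts d r"
abbreviation rts :: "nat list set \<Rightarrow> nat list set" where "rts \<equiv> co_roots d r"
abbreviation triples :: "aa_triple set" where "triples \<equiv> aa_triples d r"

lemma is_child_append [simp]: "is_child u (u @ [i])"
  by (simp add: is_child_def)

lemma is_child_unique: "is_child u v \<Longrightarrow> is_child u' v \<Longrightarrow> u = u'"
  by (auto simp: is_child_def)

lemma is_child_length: "is_child u v \<Longrightarrow> length v = Suc (length u)"
  by (auto simp: is_child_def)

lemma nil_in_V [simp]: "[] \<in> V"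
  by (simp add: tree_verts_def)

lemma snoc_in_V: "v @ [i] \<in> V \<longleftrightarrow> v \<in> V \<and> i < (if v = [] then r else d)"
  by (simp add: tree_verts_def All_less_Suc nth_append) blast

lemma prefix_in_V: "u @ s \<in> V \<Longrightarrow> u \<in> V"
  by (induction s rule: rev_induct) (auto simp: snoc_in_V simp flip: append_assoc)

text \<open>With \<open>d\<close> and \<open>r\<close> positive every vertex starts an infinite
  descending ray. Such a ray leaves any finite set, which lets germs at infinity determine values at
  a vertex in \<open>moves_unique\<close>.\<close>

lemma replicate_in_V: "v \<in> V \<Longrightarrow> v @ replicate k 0 \<in> V"
proof (induction k)
  case (Suc k)
  then have "(v @ replicate k 0) @ [0] \<in> V"
    using d_pos r_pos by (simp add: snoc_in_V del: append_assoc)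
  then show ?case by (simp flip: replicate_append_same)
qed simp

definition tree_ball :: "nat \<Rightarrow> nat list set" where
  "tree_ball n = {v \<in> V. length v \<le> n}"

lemma finite_tree_ball [simp]: "finite (tree_ball n)"
proof (rule finite_subset)
  show "tree_ball n \<subseteq> {v. set v \<subseteq> {..<r + d} \<and> length v \<le> n}"
  proof -
    have "set v \<subseteq> {..<r + d}" if "v \<in> V" for v
      using that by (fastforce simp: tree_verts_def in_set_conv_nth split: if_splits)
    then show ?thesis by (auto simp: tree_ball_def)
  qed
qed (simp add: finite_lists_length_le)

lemma admissible_tree_ball: "adm (tree_ball n)"
proof -
  have "u \<in> V" if "v \<in> V" "is_child u v" for u v
    using that by (auto simp: is_child_def snoc_in_V)
  then show ?thesis
    by (auto simp: admissible_def is_child_length) (auto simp: tree_ball_def is_child_length)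
qed

lemma admissible_empty [simp]: "adm {}"
  by (simp add: admissible_def)

lemma admissible_union: "adm F \<Longrightarrow> adm F' \<Longrightarrow> adm (F \<union> F')"
  unfolding admissible_def by blast

lemma admissible_prefix: "adm F \<Longrightarrow> u @ s \<in> F \<Longrightarrow> u \<in> F"
proof (induction s rule: rev_induct)
  case (snoc i s)
  then show ?case
    unfolding admissible_def by (metis append_assoc is_child_append)
qed simp

text \<open>The prefixes of \<open>v\<close>, itself included, are \<open>length v + 1\<close>
  distinct elements of \<open>F\<close>. Bounding the size of an admissible set thus bounds its
  depth.\<close>

lemma admissible_length_less:
  assumes "adm F" "v \<in> F"
  shows "length v < card F"
proof -
  have "take k v \<in> F" for k
    using admissible_prefix[OF assms(1), of "take k v" "drop k v"] assms(2) by simp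
  then have "(\<lambda>k. take k v) ` {..length v} \<subseteq> F" by blast
  moreover have "inj_on (\<lambda>k. take k v) {..length v}"
    by (auto intro!: inj_onI dest!: arg_cong[where f = length])
  ultimately have "card {..length v} \<le> card F"
    using assms(1) by (metis admissible_def card_image card_mono)
  then show ?thesis by simp
qed

lemma finite_set_in_tree_ball:
  assumes "finite S" "S \<subseteq> V"
  obtains n where "S \<subseteq> tree_ball n"
proof -
  have "S \<subseteq> tree_ball (Max (length ` S))"
    using assms by (auto simp: tree_ball_def)
  then show ?thesis by (rule that)
qed

lemma tree_ball_mono: "m \<le> n \<Longrightarrow> tree_ball m \<subseteq> tree_ball n"
  by (auto simp: tree_ball_def)

lemma co_verts_iff [simp]: "v \<in> co F \<longleftrightarrow> v \<in> V \<and> v \<notin> F"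
  by (simp add: co_verts_def)

text \<open>This absorbs the special case of empty \<open>F\<close>: the root \<open>[]\<close> has
  no parent, so the condition on parents is vacuous for it, and it lies outside an admissible set
  only when that set is empty.\<close>

lemma co_roots_iff:
  assumes "adm F"
  shows "v \<in> rts F \<longleftrightarrow> v \<in> co F \<and> (\<forall>u. is_child u v \<longrightarrow> u \<in> F)"
proof (cases v rule: rev_cases)
  case Nil
  have "F = {}" if "[] \<notin> F"
    using admissible_prefix[OF assms, of "[]"] that by auto
  then show ?thesis
    by (auto simp: co_roots_def Nil is_child_def)
next
  case (snoc u i)
  then show ?thesis
    by (auto simp: co_roots_def is_child_def)
qed

lemma co_roots_empty: "rts {} = {[]}"
  by (auto simp: co_roots_def)

lemma co_roots_prefix:
  assumes "adm F" "v \<in> co F"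
  obtains u s where "v = u @ s" "u \<in> rts F"
proof -
  have "\<exists>u s. v = u @ s \<and> u \<in> rts F"
    using assms(2)
  proof (induction v rule: rev_induct)
    case Nil
    then show ?case
      by (auto simp: co_roots_iff[OF assms(1)] is_child_def)
  next
    case (snoc i v)
    show ?case
    proof (cases "v \<in> F")
      case True
      then show ?thesis
        using snoc.prems by (intro exI[of _ "v @ [i]"] exI[of _ "[]"])
          (auto simp: co_roots_iff[OF assms(1)] is_child_def)
    next
      case False
      then obtain u s where "v = u @ s" "u \<in> rts F"
        using snoc by (auto simp: snoc_in_V)
      then show ?thesis
        by (intro exI[of _ u] exI[of _ "s @ [i]"]) simp
    qed
  qed
  then show ?thesis using that by blast
qed

section \<open>Forest isomorphisms\<close>

text \<open>Adjacency forgets the orientation of edges; it is recovered by induction downwards from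
  the roots, which go to vertices without a parent in the target. A first reversed edge would give
  one vertex two parents.\<close>

lemma forest_iso_is_child:
  assumes F: "adm F" "adm F'" and iso: "forest_iso d r F F' \<psi>"
    and uv: "u \<in> co F" "v \<in> co F"
  shows "is_child (\<psi> u) (\<psi> v) \<longleftrightarrow> is_child u v"
proof -
  have bij: "bij_betw \<psi> (co F) (co F')"
    and adj: "\<And>u v. u \<in> co F \<Longrightarrow> v \<in> co F \<Longrightarrow> tree_adj (\<psi> u) (\<psi> v) \<longleftrightarrow> tree_adj u v"
    and rts: "\<psi> ` rts F = rts F'"
    using iso by (auto simp: forest_iso_def)
  have child: "is_child (\<psi> v) (\<psi> (v @ [i]))" if "v \<in> co F" "v @ [i] \<in> co F" for v i
    using that
  proof (induction v arbitrary: i rule: rev_induct)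
    case Nil
    then have "\<psi> [] \<in> rts F'"
      using rts by (auto simp: co_roots_iff[OF F(1)] is_child_def)
    then have "\<not> is_child (\<psi> [i]) (\<psi> [])"
      using Nil bij by (auto simp: co_roots_iff[OF F(2)] dest!: bij_betwE)
    then show ?case
      using adj[of "[]" "[i]"] Nil by (auto simp: tree_adj_def is_child_def)
  next
    case (snoc k v)
    \<comment> \<open>If this edge were reversed, both the image of \<open>v\<close> and the image
      of \<open>(v @ [k]) @ [i]\<close> would be the parent of the image of \<open>v @ [k]\<close>,
      against injectivity.\<close>
    have "\<not> is_child (\<psi> ((v @ [k]) @ [i])) (\<psi> (v @ [k]))"
    proof
      assume *: "is_child (\<psi> ((v @ [k]) @ [i])) (\<psi> (v @ [k]))"
      have "\<psi> ((v @ [k]) @ [i]) \<in> co F'"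
        using bij snoc.prems by (meson bij_betwE)
      then have "\<psi> (v @ [k]) \<notin> rts F'"
        using * by (auto simp: co_roots_iff[OF F(2)])
      then have "v @ [k] \<notin> rts F"
        using rts by blast
      then have "v \<in> co F"
        using snoc.prems(1) by (auto simp: co_roots_iff[OF F(1)] is_child_def snoc_in_V)
      then have "is_child (\<psi> v) (\<psi> (v @ [k]))"
        using snoc by blast
      then have "\<psi> v = \<psi> ((v @ [k]) @ [i])"
        using * is_child_unique by blast
      then have "v = (v @ [k]) @ [i]"
        using bij \<open>v \<in> co F\<close> snoc.prems by (meson bij_betw_def inj_on_def)
      then show False by simp
    qed
    then show ?case
      using adj[OF snoc.prems] by (auto simp: tree_adj_def is_child_def)
  qed
  have child': "is_child (\<psi> u) (\<psi> v)" if "u \<in> co F" "v \<in> co F" "is_child u v" for u v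
    using that child by (auto simp: is_child_def)
  show ?thesis
  proof
    assume *: "is_child (\<psi> u) (\<psi> v)"
    then have "tree_adj u v"
      using adj[OF uv] by (simp add: tree_adj_def)
    moreover have "\<not> is_child v u"
      using child'[OF uv(2,1)] is_child_length[OF *] is_child_length[of "\<psi> v" "\<psi> u"] by auto
    ultimately show "is_child u v" by (simp add: tree_adj_def)
  qed (use child' uv in blast)
qed

text \<open>Roots need no separate condition: they are the vertices of the complement without a parent
  in it.\<close>

lemma aa_triples_iff:
  "(\<psi>, F, F') \<in> triples \<longleftrightarrow> adm F \<and> adm F' \<and> \<psi> \<in> extensional (co F) \<and>
    bij_betw \<psi> (co F) (co F') \<and> (\<forall>u\<in>co F. \<forall>v\<in>co F. is_child (\<psi> u) (\<psi> v) \<longleftrightarrow> is_child u v)"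
  (is "?L \<longleftrightarrow> ?R")
proof
  assume ?L
  then show ?R
    using forest_iso_is_child by (auto simp: aa_triples_def forest_iso_def)
next
  assume R: ?R
  then have F: "adm F" "adm F'" and bij: "bij_betw \<psi> (co F) (co F')"
    and child: "\<And>u v. u \<in> co F \<Longrightarrow> v \<in> co F \<Longrightarrow> is_child (\<psi> u) (\<psi> v) \<longleftrightarrow> is_child u v"
    by blast+
  have roots: "v \<in> rts F \<longleftrightarrow> v \<in> co F \<and> (\<forall>u\<in>co F. \<not> is_child u v)" if "adm F" for v F
    using that by (auto simp: co_roots_iff is_child_def snoc_in_V)
  have "v \<in> rts F \<longleftrightarrow> \<psi> v \<in> rts F'" if "v \<in> co F" for v
  proof -
    have "(\<forall>u\<in>co F'. \<not> is_child u (\<psi> v)) \<longleftrightarrow> (\<forall>u\<in>co F. \<not> is_child (\<psi> u) (\<psi> v))"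
      using bij by (metis (no_types, lifting) bij_betw_def image_iff)
    then show ?thesis
      unfolding roots[OF F(1)] roots[OF F(2)] using that bij child by (metis bij_betwE)
  qed
  moreover have "rts F \<subseteq> co F" "rts F' \<subseteq> \<psi> ` co F"
    using roots F bij by (auto simp: bij_betw_def)
  ultimately have "\<psi> ` rts F = rts F'" by blast
  then show ?L
    using R by (simp add: aa_triples_def forest_iso_def tree_adj_def)
qed

lemma aa_triples_child:
  assumes "(\<psi>, F, F') \<in> triples" "v \<in> co F" "v @ [i] \<in> V"
  shows "v @ [i] \<in> co F" "\<exists>j. \<psi> (v @ [i]) = \<psi> v @ [j]"
proof -
  show *: "v @ [i] \<in> co F"
    using assms admissible_prefix[of F v "[i]"] by (auto simp: aa_triples_iff)
  then show "\<exists>j. \<psi> (v @ [i]) = \<psi> v @ [j]"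
    using assms unfolding aa_triples_iff by (metis is_child_append is_child_def)
qed

lemma aa_triples_image: "(\<psi>, F, F') \<in> triples \<Longrightarrow> v \<in> co F \<Longrightarrow> \<psi> v \<in> co F'"
  unfolding aa_triples_iff by (meson bij_betwE)

text \<open>Enlarging the source set forces the target set to be everything missed by the restricted
  map. It is finite because it adds at most the image of \<open>G\<close> to \<open>F'\<close>, and
  closed under parents because \<open>\<psi>\<close> respects children and \<open>G\<close> is
  itself closed under parents.\<close>

lemma aa_triples_restrict:
  assumes t: "(\<psi>, F, F') \<in> triples" and G: "adm G" "F \<subseteq> G"
  shows "(restrict \<psi> (co G), G, V - \<psi> ` co G) \<in> triples" "F' \<subseteq> V - \<psi> ` co G"
proof -
  note t' = t[unfolded aa_triples_iff]
  have bij: "bij_betw \<psi> (co F) (co F')" using t' by blast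
  have sub: "co G \<subseteq> co F" using G(2) by auto
  have img: "\<psi> ` co G \<subseteq> co F'" using bij sub by (auto simp: bij_betw_def)
  show "F' \<subseteq> V - \<psi> ` co G"
    using img t' by (auto simp: admissible_def)
  \<comment> \<open>This superset is chosen for its finiteness; the part of \<open>G\<close> inside
    \<open>F\<close> contributes at most the default value of the extensional map
    \<open>\<psi>\<close>.\<close>
  have "V - \<psi> ` co G \<subseteq> F' \<union> \<psi> ` G"
  proof
    fix v assume v: "v \<in> V - \<psi> ` co G"
    show "v \<in> F' \<union> \<psi> ` G"
    proof (cases "v \<in> F'")
      case False
      then have "v \<in> co F'" using v by simp
      then have "v \<in> \<psi> ` co F" using bij by (simp add: bij_betw_def)
      then obtain x where x: "x \<in> co F" "v = \<psi> x" by blast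
      then have "x \<in> G" using v by auto
      then show ?thesis using x by blast
    qed simp
  qed
  then have "finite (V - \<psi> ` co G)"
    using t' G by (meson admissible_def finite_UnI finite_imageI finite_subset)
  moreover have "u \<in> V - \<psi> ` co G" if v: "v \<in> V - \<psi> ` co G" and uv: "is_child u v" for u v
  proof -
    have uV: "u \<in> V" using v uv by (auto simp: is_child_def snoc_in_V)
    moreover have "u \<notin> \<psi> ` co G"
    proof
      assume "u \<in> \<psi> ` co G"
      then obtain u' where u': "u' \<in> co G" "u = \<psi> u'" by blast
      then have "u \<in> co F'" using img by blast
      then have "u \<notin> F'" by simp
      then have "v \<notin> F'" using t' uv by (auto simp: admissible_def)
      then have "v \<in> \<psi> ` co F" using bij v by (simp add: bij_betw_def)
      then obtain v' where v': "v' \<in> co F" "v = \<psi> v'" by blast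
      then have "is_child u' v'" using t' u' uv sub by blast
      then have "v' \<notin> G" using u' G by (auto simp: admissible_def)
      then show False using v v' by auto
    qed
    ultimately show ?thesis by simp
  qed
  ultimately have adm: "adm (V - \<psi> ` co G)"
    unfolding admissible_def by blast
  have "co (V - \<psi> ` co G) = \<psi> ` co G" using img by auto
  then have "bij_betw (restrict \<psi> (co G)) (co G) (co (V - \<psi> ` co G))"
    by (simp only:) (rule bij_betw_cong[THEN iffD1, OF _ bij_betw_subset[OF bij sub refl]], simp)
  then show "(restrict \<psi> (co G), G, V - \<psi> ` co G) \<in> triples"
    using adm G t' sub by (auto simp: aa_triples_iff subset_iff)
qed

lemma aa_triples_inverse:
  assumes "(\<psi>, F, F') \<in> triples"
  shows "(restrict (inv_into (co F) \<psi>) (co F'), F', F) \<in> triples"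
proof -
  note t = assms[unfolded aa_triples_iff]
  have bij: "bij_betw \<psi> (co F) (co F')" using t by blast
  have "bij_betw (restrict (inv_into (co F) \<psi>) (co F')) (co F') (co F)"
    by (rule bij_betw_cong[THEN iffD1, OF _ bij_betw_inv_into[OF bij]]) simp
  moreover have "is_child (inv_into (co F) \<psi> u) (inv_into (co F) \<psi> v) \<longleftrightarrow> is_child u v"
    if "u \<in> co F'" "v \<in> co F'" for u v
  proof -
    have "inv_into (co F) \<psi> w \<in> co F" "\<psi> (inv_into (co F) \<psi> w) = w" if "w \<in> co F'" for w
      using that bij bij_betw_inv_into_right[OF bij] bij_betwE[OF bij_betw_inv_into[OF bij]] by blast+
    then show ?thesis using t \<open>u \<in> co F'\<close> \<open>v \<in> co F'\<close> by metis
  qed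
  ultimately show ?thesis
    using t by (auto simp: aa_triples_iff)
qed

lemma aa_triples_compose:
  assumes "(\<psi>, F', F'') \<in> triples" "(\<phi>, F, F') \<in> triples"
  shows "(compose (co F) \<psi> \<phi>, F, F'') \<in> triples"
proof -
  have "bij_betw (compose (co F) \<psi> \<phi>) (co F) (co F'')"
    using assms by (auto simp: aa_triples_iff intro: bij_betw_compose)
  moreover have "is_child (compose (co F) \<psi> \<phi> u) (compose (co F) \<psi> \<phi> v) \<longleftrightarrow> is_child u v"
    if "u \<in> co F" "v \<in> co F" for u v
    using that aa_triples_image[OF assms(2)] assms by (simp add: compose_def aa_triples_iff)
  ultimately show ?thesis
    using assms by (auto simp: aa_triples_iff)
qed

text \<open>Restricting the inverse isomorphism to \<open>co G\<close> and inverting again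
  prescribes the target set instead of the source set. Composition needs this to match the target of
  one map with the source of another.\<close>

lemma aa_triples_restrict_target:
  assumes t: "(\<phi>, F, F') \<in> triples" and G: "adm G" "F' \<subseteq> G"
  obtains H where "(restrict \<phi> (co H), H, G) \<in> triples" "co H = {v \<in> co F. \<phi> v \<in> co G}"
proof -
  let ?\<chi> = "restrict (inv_into (co F) \<phi>) (co F')"
  have bij: "bij_betw \<phi> (co F) (co F')" using t by (simp add: aa_triples_iff)
  note r = aa_triples_restrict[OF aa_triples_inverse[OF t] G]
  define H where "H = V - ?\<chi> ` co G"
  have "co G \<subseteq> co F'" using G(2) by auto
  have img: "?\<chi> ` co G = {v \<in> co F. \<phi> v \<in> co G}" (is "_ = ?S")
  proof
    show "?\<chi> ` co G \<subseteq> ?S"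
      using \<open>co G \<subseteq> co F'\<close> bij bij_betw_inv_into_right[OF bij] bij_betwE[OF bij_betw_inv_into[OF bij]]
      by fastforce
    show "?S \<subseteq> ?\<chi> ` co G"
    proof
      fix v assume v: "v \<in> ?S"
      then have "?\<chi> (\<phi> v) = v"
        using \<open>co G \<subseteq> co F'\<close> bij by (auto simp: bij_betw_inv_into_left)
      then show "v \<in> ?\<chi> ` co G" using v by (metis (mono_tags) imageI mem_Collect_eq)
    qed
  qed
  then have coH: "co H = ?S" by (auto simp: H_def)
  have "adm H" using r(1) by (simp add: H_def aa_triples_iff)
  moreover have "F \<subseteq> H" using r(2) by (simp add: H_def)
  ultimately have 1: "(restrict \<phi> (co H), H, V - \<phi> ` co H) \<in> triples"
    by (rule aa_triples_restrict(1)[OF t])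
  have "\<phi> ` co H = co G"
  proof -
    have "co G \<subseteq> \<phi> ` co F" using \<open>co G \<subseteq> co F'\<close> bij by (simp add: bij_betw_def)
    then show ?thesis unfolding coH by blast
  qed
  then have "V - \<phi> ` co H = G"
    using G(1) by (auto simp: admissible_def)
  then show ?thesis
    using 1 coH that by simp
qed

section \<open>Germs at infinity and the group structure\<close>

text \<open>Equality of germs at infinity. Values at finitely many vertices and off the tree do not
  matter, so restrictions may be dropped and plain composition used.\<close>

definition ev_eq :: "(nat list \<Rightarrow> nat list) \<Rightarrow> (nat list \<Rightarrow> nat list) \<Rightarrow> bool" where
  "ev_eq f g \<longleftrightarrow> finite {v \<in> V. f v \<noteq> g v}"

lemma ev_eqI: "finite S \<Longrightarrow> (\<And>v. v \<in> V \<Longrightarrow> v \<notin> S \<Longrightarrow> f v = g v) \<Longrightarrow> ev_eq f g"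
  unfolding ev_eq_def by (rule finite_subset[of _ S]) auto

lemma ev_eq_refl [simp]: "ev_eq f f"
  by (simp add: ev_eq_def)

lemma ev_eq_sym: "ev_eq f g \<Longrightarrow> ev_eq g f"
  by (simp add: ev_eq_def eq_commute)

lemma ev_eq_trans: "ev_eq f g \<Longrightarrow> ev_eq g h \<Longrightarrow> ev_eq f h"
  unfolding ev_eq_def
  by (rule finite_subset[of _ "{v \<in> V. f v \<noteq> g v} \<union> {v \<in> V. g v \<noteq> h v}"]) auto

lemma ev_eq_restrict: "adm F \<Longrightarrow> ev_eq (restrict f (co F)) f"
  by (rule ev_eqI[of F]) (auto simp: admissible_def)

lemma ev_eq_compose: "adm F \<Longrightarrow> ev_eq (compose (co F) f g) (f \<circ> g)"
  by (rule ev_eqI[of F]) (auto simp: admissible_def compose_def)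

text \<open>The places where the outer maps differ must be pulled back along the inner one;
  injectivity of \<open>\<phi>\<close> on the cofinite set \<open>co F\<close> keeps the preimage
  finite.\<close>

lemma ev_eq_comp:
  assumes "ev_eq f' f" "ev_eq g' \<phi>" "(\<phi>, F, F') \<in> triples"
  shows "ev_eq (f' \<circ> g') (f \<circ> \<phi>)"
proof -
  let ?S = "{v \<in> V. g' v \<noteq> \<phi> v} \<union> F \<union> (\<phi> -` {w \<in> V. f' w \<noteq> f w} \<inter> co F)"
  have "inj_on \<phi> (co F)" "finite F"
    using assms(3) by (auto simp: aa_triples_iff bij_betw_def admissible_def)
  moreover from this have "finite (\<phi> -` {w \<in> V. f' w \<noteq> f w} \<inter> co F)"
    using assms(1) unfolding ev_eq_def by (intro finite_vimage_IntI)
  ultimately have "finite ?S"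
    using assms(2) by (simp add: ev_eq_def)
  then show ?thesis
    by (rule ev_eqI) (use aa_triples_image[OF assms(3)] in auto)
qed

text \<open>A ball containing \<open>F\<^sub>1\<close>, \<open>F\<^sub>2\<close> and the finite set
  of disagreement is a common refinement, and equal restrictions have the same image, which
  determines the common target set.\<close>

lemma aa_rel_iff:
  "((\<psi>\<^sub>1, F\<^sub>1, F\<^sub>1'), (\<psi>\<^sub>2, F\<^sub>2, F\<^sub>2')) \<in> aa_rel d r \<longleftrightarrow>
    (\<psi>\<^sub>1, F\<^sub>1, F\<^sub>1') \<in> triples \<and> (\<psi>\<^sub>2, F\<^sub>2, F\<^sub>2') \<in> triples \<and> ev_eq \<psi>\<^sub>1 \<psi>\<^sub>2"
  (is "?L \<longleftrightarrow> ?R")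
proof
  assume ?L
  then obtain F where t: "(\<psi>\<^sub>1, F\<^sub>1, F\<^sub>1') \<in> triples" "(\<psi>\<^sub>2, F\<^sub>2, F\<^sub>2') \<in> triples" and F: "adm F"
    and eq: "restrict \<psi>\<^sub>1 (co F) = restrict \<psi>\<^sub>2 (co F)"
    unfolding aa_rel_def by blast
  have "ev_eq \<psi>\<^sub>1 \<psi>\<^sub>2"
    using F ev_eq_restrict ev_eq_sym ev_eq_trans eq by metis
  then show ?R using t by blast
next
  assume R: ?R
  let ?S = "F\<^sub>1 \<union> F\<^sub>2 \<union> {v \<in> V. \<psi>\<^sub>1 v \<noteq> \<psi>\<^sub>2 v}"
  have "finite ?S" "?S \<subseteq> V"
    using R by (auto simp: aa_triples_iff admissible_def ev_eq_def)
  then obtain n where n: "?S \<subseteq> tree_ball n" by (rule finite_set_in_tree_ball)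
  let ?F = "tree_ball n" and ?F' = "V - \<psi>\<^sub>1 ` co (tree_ball n)"
  have eq: "\<psi>\<^sub>1 v = \<psi>\<^sub>2 v" if "v \<in> co ?F" for v
    using that n by auto
  have t1: "(\<psi>\<^sub>1, F\<^sub>1, F\<^sub>1') \<in> triples" "F\<^sub>1 \<subseteq> ?F" and t2: "(\<psi>\<^sub>2, F\<^sub>2, F\<^sub>2') \<in> triples" "F\<^sub>2 \<subseteq> ?F"
    using R n by auto
  note r1 = aa_triples_restrict[OF t1(1) admissible_tree_ball t1(2)]
  note r2 = aa_triples_restrict(2)[OF t2(1) admissible_tree_ball t2(2)]
  have "\<psi>\<^sub>2 ` co ?F = \<psi>\<^sub>1 ` co ?F"
    using eq by (metis image_cong)
  moreover have "restrict \<psi>\<^sub>1 (co ?F) = restrict \<psi>\<^sub>2 (co ?F)"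
    using eq by (simp cong: restrict_cong)
  ultimately
    have "adm ?F \<and> adm ?F' \<and> F\<^sub>1 \<union> F\<^sub>2 \<subseteq> ?F \<and> F\<^sub>1' \<union> F\<^sub>2' \<subseteq> ?F' \<and>
      restrict \<psi>\<^sub>1 (co ?F) = restrict \<psi>\<^sub>2 (co ?F) \<and> forest_iso d r ?F ?F' (restrict \<psi>\<^sub>1 (co ?F))"
    using t1(2) t2(2) r1 r2 by (simp add: aa_triples_def)
  then show ?L
    using t1(1) t2(1) unfolding aa_rel_def by blast
qed

text \<open>Allowing an arbitrary function lets \<open>id\<close> and plain compositions name
  classes, although they are not extensional on a complement forest.\<close>

definition germ_class :: "(nat list \<Rightarrow> nat list) \<Rightarrow> aa_triple set" where
  "germ_class f = {t \<in> triples. ev_eq (fst t) f}"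

lemma aa_class_eq: "(\<psi>, F, F') \<in> triples \<Longrightarrow> aa_class d r (\<psi>, F, F') = germ_class \<psi>"
  by (auto simp: aa_class_def germ_class_def aa_rel_iff intro: ev_eq_sym)

lemma germ_class_cong: "ev_eq f g \<Longrightarrow> germ_class f = germ_class g"
  by (auto simp: germ_class_def intro: ev_eq_sym ev_eq_trans)

lemma germ_class_eqD: "germ_class f = germ_class g \<Longrightarrow> t \<in> germ_class f \<Longrightarrow> ev_eq f g"
  by (auto simp: germ_class_def intro: ev_eq_sym ev_eq_trans)

section \<open>The group law computed on germs\<close>

abbreviation N :: "aa_triple set monoid" where "N \<equiv> neretin d r"

lemma carrier_neretin: "carrier N = {germ_class \<psi> | \<psi> F F'. (\<psi>, F, F') \<in> triples}"
proof -
  have "carrier N = (\<lambda>t. aa_class d r t) ` triples"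
    by (auto simp: neretin_def quotient_def aa_class_def)
  also have "\<dots> = (\<lambda>t. germ_class (fst t)) ` triples"
    by (rule image_cong) (auto simp: aa_class_eq)
  also have "\<dots> = {germ_class \<psi> | \<psi> F F'. (\<psi>, F, F') \<in> triples}"
    by force
  finally show ?thesis .
qed

lemma germ_class_carrier: "(\<psi>, F, F') \<in> triples \<Longrightarrow> germ_class \<psi> \<in> carrier N"
  by (auto simp: carrier_neretin)

lemma neretin_rep:
  assumes "A \<in> carrier N" "(\<psi>, F, F') \<in> A"
  shows "A = germ_class \<psi>" "(\<psi>, F, F') \<in> triples"
proof -
  obtain \<phi> where \<phi>: "A = germ_class \<phi>"
    using assms(1) by (auto simp: carrier_neretin)
  then show "(\<psi>, F, F') \<in> triples" "A = germ_class \<psi>"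
    using assms(2) germ_class_cong[of \<psi> \<phi>] by (auto simp: germ_class_def)
qed

lemma neretin_repE:
  assumes "A \<in> carrier N"
  obtains \<psi> F F' where "(\<psi>, F, F') \<in> A" "A = germ_class \<psi>" "(\<psi>, F, F') \<in> triples"
  using assms by (auto simp: carrier_neretin germ_class_def)

text \<open>The middle set \<open>F' \<union> E\<close> works for both maps. The final clause
  records that no point of the domain of the composite is lost, which \<open>moves_mult\<close>
  needs beyond the equality of germs.\<close>

lemma aa_triples_match:
  assumes "(\<psi>, E, E') \<in> triples" "(\<phi>, F, F') \<in> triples"
  obtains \<psi>' \<phi>' H G G' where "(\<psi>', G, G') \<in> triples" "(\<phi>', H, G) \<in> triples"
    "ev_eq \<psi>' \<psi>" "ev_eq \<phi>' \<phi>"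
    "\<And>v. v \<in> co F \<Longrightarrow> \<phi> v \<in> co E \<Longrightarrow> v \<in> co H \<and> \<psi>' (\<phi>' v) = \<psi> (\<phi> v)"
proof -
  let ?G = "F' \<union> E"
  have G: "adm ?G" using assms by (auto simp: aa_triples_iff intro: admissible_union)
  obtain H where H: "(restrict \<phi> (co H), H, ?G) \<in> triples" "co H = {v \<in> co F. \<phi> v \<in> co ?G}"
    using aa_triples_restrict_target[OF assms(2) G] by auto
  have \<psi>: "(restrict \<psi> (co ?G), ?G, V - \<psi> ` co ?G) \<in> triples"
    using assms G by (intro aa_triples_restrict(1)) auto
  have "v \<in> co H \<and> restrict \<psi> (co ?G) (restrict \<phi> (co H) v) = \<psi> (\<phi> v)"
    if "v \<in> co F" "\<phi> v \<in> co E" for v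
    using that aa_triples_image[OF assms(2) that(1)] unfolding H(2) by simp
  moreover have "ev_eq (restrict \<psi> (co ?G)) \<psi>" "ev_eq (restrict \<phi> (co H)) \<phi>"
    using G H(1) by (simp_all add: ev_eq_restrict aa_triples_iff)
  ultimately show ?thesis
    using that[OF \<psi> H(1)] by blast
qed

text \<open>By \<open>ev_eq_comp\<close> all products of representatives have one germ, so the union
  defining the product has a single member; the matched pair shows that it is not empty.\<close>

lemma mult_germ_class_matched:
  assumes "(\<psi>, F', F'') \<in> triples" "(\<phi>, F, F') \<in> triples"
  shows "germ_class \<psi> \<otimes>\<^bsub>N\<^esub> germ_class \<phi> = germ_class (\<psi> \<circ> \<phi>)"
proof -
  have "aa_class d r (compose (co F1) \<psi>1 \<phi>1, F1, F1'') = germ_class (\<psi> \<circ> \<phi>)"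
    if "(\<psi>1, F1', F1'') \<in> germ_class \<psi>" "(\<phi>1, F1, F1') \<in> germ_class \<phi>" for \<psi>1 \<phi>1 F1 F1' F1''
  proof -
    have t: "(\<psi>1, F1', F1'') \<in> triples" "(\<phi>1, F1, F1') \<in> triples" "ev_eq \<psi>1 \<psi>" "ev_eq \<phi>1 \<phi>"
      using that by (auto simp: germ_class_def)
    have "adm F1" using t by (simp add: aa_triples_iff)
    then have "ev_eq (compose (co F1) \<psi>1 \<phi>1) (\<psi> \<circ> \<phi>)"
      using ev_eq_compose ev_eq_comp[OF t(3,4) assms(2)] ev_eq_trans by blast
    then show ?thesis
      using aa_class_eq[OF aa_triples_compose[OF t(1,2)]] germ_class_cong by simp
  qed
  note eq = this
  have mem: "(\<psi>, F', F'') \<in> germ_class \<psi>" "(\<phi>, F, F') \<in> germ_class \<phi>"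
    using assms by (auto simp: germ_class_def)
  have "{aa_class d r (compose (co F) \<psi>' \<phi>', F, F'') |
      \<psi>' \<phi>' F F' F''. (\<psi>', F', F'') \<in> germ_class \<psi> \<and> (\<phi>', F, F') \<in> germ_class \<phi>} =
    {germ_class (\<psi> \<circ> \<phi>)}" (is "?L = _")
  proof
    show "?L \<subseteq> {germ_class (\<psi> \<circ> \<phi>)}" using eq by blast
    show "{germ_class (\<psi> \<circ> \<phi>)} \<subseteq> ?L" using eq[OF mem] mem by blast
  qed
  then show ?thesis by (simp add: neretin_def)
qed

lemma
  assumes f: "germ_class f \<in> carrier N" and g: "germ_class g \<in> carrier N"
  shows mult_germ_class: "germ_class f \<otimes>\<^bsub>N\<^esub> germ_class g = germ_class (f \<circ> g)"
    and germ_class_comp_carrier: "germ_class (f \<circ> g) \<in> carrier N"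
proof -
  obtain \<psi> E E' where \<psi>: "(\<psi>, E, E') \<in> triples" "ev_eq \<psi> f"
    using neretin_repE[OF f] by (metis (no_types, lifting) germ_class_def mem_Collect_eq fst_conv)
  obtain \<phi> F F' where \<phi>: "(\<phi>, F, F') \<in> triples" "ev_eq \<phi> g"
    using neretin_repE[OF g] by (metis (no_types, lifting) germ_class_def mem_Collect_eq fst_conv)
  obtain \<psi>' \<phi>' H G G' where t: "(\<psi>', G, G') \<in> triples" "(\<phi>', H, G) \<in> triples"
    and "ev_eq \<psi>' \<psi>" "ev_eq \<phi>' \<phi>"
    using aa_triples_match[OF \<psi>(1) \<phi>(1)] by metis
  then have ev: "ev_eq f \<psi>'" "ev_eq g \<phi>'"
    using \<psi>(2) \<phi>(2) by (meson ev_eq_sym ev_eq_trans)+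
  have "germ_class f \<otimes>\<^bsub>N\<^esub> germ_class g = germ_class (\<psi>' \<circ> \<phi>')"
    using mult_germ_class_matched[OF t] germ_class_cong ev by simp
  also have eq: "germ_class (\<psi>' \<circ> \<phi>') = germ_class (f \<circ> g)"
    using ev_eq_comp[OF ev t(2)] germ_class_cong by metis
  finally show "germ_class f \<otimes>\<^bsub>N\<^esub> germ_class g = germ_class (f \<circ> g)" .
  have "adm H" using t by (simp add: aa_triples_iff)
  then have "germ_class (\<psi>' \<circ> \<phi>') = germ_class (compose (co H) \<psi>' \<phi>')"
    using ev_eq_compose germ_class_cong by metis
  then show "germ_class (f \<circ> g) \<in> carrier N"
    using eq germ_class_carrier[OF aa_triples_compose[OF t]] by simp
qed

lemma tree_aut_iff: "k \<in> tree_aut d r \<longleftrightarrow> (k, {}, {}) \<in> triples"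
  by (simp add: tree_aut_def aa_triples_def)

lemma aut_to_aa_eq: "k \<in> tree_aut d r \<Longrightarrow> aut_to_aa d r k = germ_class k"
  by (simp add: aut_to_aa_def tree_aut_iff aa_class_eq)

lemma aut_to_aa_carrier: "k \<in> tree_aut d r \<Longrightarrow> aut_to_aa d r k \<in> carrier N"
  by (simp add: aut_to_aa_eq tree_aut_iff germ_class_carrier)

lemma id_tree_aut: "restrict id V \<in> tree_aut d r"
  by (simp add: tree_aut_iff aa_triples_iff co_verts_def bij_betw_def inj_on_def)

lemma one_neretin: "\<one>\<^bsub>N\<^esub> = germ_class id"
proof -
  have "\<one>\<^bsub>N\<^esub> = germ_class (restrict id V)"
    using aut_to_aa_eq[OF id_tree_aut] by (simp add: neretin_def)
  also have "\<dots> = germ_class id"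
    by (intro germ_class_cong ev_eqI[of "{}"]) auto
  finally show ?thesis .
qed

lemma germ_class_inverse:
  assumes "(\<psi>, F, F') \<in> triples"
  shows "germ_class (restrict (inv_into (co F) \<psi>) (co F')) \<otimes>\<^bsub>N\<^esub> germ_class \<psi> = \<one>\<^bsub>N\<^esub>"
proof -
  have "germ_class (restrict (inv_into (co F) \<psi>) (co F')) \<otimes>\<^bsub>N\<^esub> germ_class \<psi> =
      germ_class (restrict (inv_into (co F) \<psi>) (co F') \<circ> \<psi>)"
    by (rule mult_germ_class[OF germ_class_carrier[OF aa_triples_inverse[OF assms]]
      germ_class_carrier[OF assms]])
  also have "\<dots> = germ_class id"
    using assms aa_triples_image[OF assms]
    by (intro germ_class_cong ev_eqI[of F]) (auto simp: aa_triples_iff admissible_def bij_betw_def)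
  finally show ?thesis by (simp add: one_neretin)
qed

lemma group_neretin: "group N"
proof (rule groupI)
  show one: "\<one>\<^bsub>N\<^esub> \<in> carrier N"
    using aut_to_aa_carrier[OF id_tree_aut] by (simp add: neretin_def)
  fix A B C assume A: "A \<in> carrier N" and B: "B \<in> carrier N" and C: "C \<in> carrier N"
  obtain f where f: "A = germ_class f" using A by (auto simp: carrier_neretin)
  obtain g where g: "B = germ_class g" using B by (auto simp: carrier_neretin)
  obtain h where h: "C = germ_class h" using C by (auto simp: carrier_neretin)
  show "A \<otimes>\<^bsub>N\<^esub> B \<in> carrier N"
    using A B by (simp add: f g mult_germ_class germ_class_comp_carrier)
  show "(A \<otimes>\<^bsub>N\<^esub> B) \<otimes>\<^bsub>N\<^esub> C = A \<otimes>\<^bsub>N\<^esub> (B \<otimes>\<^bsub>N\<^esub> C)"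
    using A B C by (simp add: f g h mult_germ_class germ_class_comp_carrier comp_assoc)
  show "\<one>\<^bsub>N\<^esub> \<otimes>\<^bsub>N\<^esub> A = A"
    using one A by (simp add: one_neretin f mult_germ_class)
  obtain \<psi> F F' where "A = germ_class \<psi>" "(\<psi>, F, F') \<in> triples"
    using A by (rule neretin_repE)
  then show "\<exists>B\<in>carrier N. B \<otimes>\<^bsub>N\<^esub> A = \<one>\<^bsub>N\<^esub>"
    using germ_class_inverse germ_class_carrier aa_triples_inverse by blast
qed

sublocale N: group N
  by (rule group_neretin)

lemma inv_germ_class:
  assumes "(\<psi>, F, F') \<in> triples"
  shows "inv\<^bsub>N\<^esub> (germ_class \<psi>) = germ_class (restrict (inv_into (co F) \<psi>) (co F'))"
  by (rule N.inv_equality[OF germ_class_inverse[OF assms] germ_class_carrier[OF assms]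
      germ_class_carrier[OF aa_triples_inverse[OF assms]]])

section \<open>The action of almost automorphisms on subtrees\<close>

text \<open>\<open>moves A v w\<close> means that \<open>A\<close> maps the subtree below \<open>v\<close> isomorphically onto the subtree
  below \<open>w\<close>.\<close>

definition moves :: "aa_triple set \<Rightarrow> nat list \<Rightarrow> nat list \<Rightarrow> bool" where
  "moves A v w \<longleftrightarrow> (\<exists>\<psi> F F'. (\<psi>, F, F') \<in> A \<and> v \<in> co F \<and> w = \<psi> v)"

lemma moves_in_V: "A \<in> carrier N \<Longrightarrow> moves A v w \<Longrightarrow> v \<in> V \<and> w \<in> V"
  unfolding moves_def using aa_triples_image neretin_rep(2) by fastforce

lemma moves_aut: "k \<in> tree_aut d r \<Longrightarrow> v \<in> V \<Longrightarrow> moves (aut_to_aa d r k) v (k v)"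
  unfolding moves_def
  by (rule exI[of _ k], rule exI[of _ "{}"], rule exI[of _ "{}"])
    (simp add: aut_to_aa_eq germ_class_def tree_aut_iff)

lemma moves_one: "v \<in> V \<Longrightarrow> moves \<one>\<^bsub>N\<^esub> v v"
  using moves_aut[OF id_tree_aut] by (simp add: neretin_def)

lemma moves_mult:
  assumes "A \<in> carrier N" "B \<in> carrier N" "moves B u v" "moves A v w"
  shows "moves (A \<otimes>\<^bsub>N\<^esub> B) u w"
proof -
  obtain \<phi> F F' where \<phi>: "(\<phi>, F, F') \<in> B" "u \<in> co F" "v = \<phi> u"
    using assms by (auto simp: moves_def)
  obtain \<psi> E E' where \<psi>: "(\<psi>, E, E') \<in> A" "v \<in> co E" "w = \<psi> v"
    using assms by (auto simp: moves_def)
  note A = neretin_rep[OF assms(1) \<psi>(1)] and B = neretin_rep[OF assms(2) \<phi>(1)]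
  obtain \<psi>' \<phi>' H G G' where t: "(\<psi>', G, G') \<in> triples" "(\<phi>', H, G) \<in> triples"
    and ev: "ev_eq \<psi>' \<psi>" "ev_eq \<phi>' \<phi>" and u: "u \<in> co H" "\<psi>' (\<phi>' u) = \<psi> (\<phi> u)"
    using aa_triples_match[OF A(2) B(2)] \<phi> \<psi> by metis
  have "A \<otimes>\<^bsub>N\<^esub> B = germ_class (\<psi>' \<circ> \<phi>')"
    using mult_germ_class_matched[OF t] A(1) B(1) germ_class_cong ev by metis
  moreover have "(compose (co H) \<psi>' \<phi>', H, G') \<in> germ_class (\<psi>' \<circ> \<phi>')"
    using t aa_triples_compose[OF t] by (auto simp: germ_class_def aa_triples_iff intro: ev_eq_compose)
  ultimately show ?thesis
    unfolding moves_def using u \<phi> \<psi> by (metis compose_eq)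
qed

lemma moves_inv:
  assumes "A \<in> carrier N" "moves A v w"
  shows "moves (inv\<^bsub>N\<^esub> A) w v"
proof -
  obtain \<psi> F F' where \<psi>: "(\<psi>, F, F') \<in> A" "v \<in> co F" "w = \<psi> v"
    using assms by (auto simp: moves_def)
  note A = neretin_rep[OF assms(1) \<psi>(1)]
  let ?\<chi> = "restrict (inv_into (co F) \<psi>) (co F')"
  have "(?\<chi>, F', F) \<in> inv\<^bsub>N\<^esub> A"
    using aa_triples_inverse[OF A(2)] inv_germ_class[OF A(2)] A(1) by (simp add: germ_class_def)
  moreover have "w \<in> co F'" "?\<chi> w = v"
    using \<psi> A(2) aa_triples_image[OF A(2)] by (auto simp: aa_triples_iff bij_betw_def)
  ultimately show ?thesis
    unfolding moves_def by metis
qed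

lemma moves_child:
  assumes "A \<in> carrier N" "moves A v w" "v @ [i] \<in> V"
  shows "\<exists>j. moves A (v @ [i]) (w @ [j])"
proof -
  obtain \<psi> F F' where \<psi>: "(\<psi>, F, F') \<in> A" "v \<in> co F" "w = \<psi> v"
    using assms by (auto simp: moves_def)
  have "v @ [i] \<in> co F" "\<exists>j. \<psi> (v @ [i]) = w @ [j]"
    using aa_triples_child[OF neretin_rep(2)[OF assms(1) \<psi>(1)] \<psi>(2) assms(3)] \<psi>(3) by auto
  then show ?thesis
    unfolding moves_def using \<psi>(1) by metis
qed

lemma moves_descendant:
  assumes "A \<in> carrier N" "moves A v w" "v @ s \<in> V"
  shows "\<exists>s'. length s' = length s \<and> moves A (v @ s) (w @ s')"
  using assms(3)
proof (induction s rule: rev_induct)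
  case (snoc i s)
  then obtain s' where s': "length s' = length s" "moves A (v @ s) (w @ s')"
    using prefix_in_V[of "v @ s" "[i]"] by auto
  then obtain j where "moves A ((v @ s) @ [i]) ((w @ s') @ [j])"
    using moves_child[OF assms(1)] snoc.prems by fastforce
  then show ?case
    using s'(1) by (intro exI[of _ "s' @ [j]"]) simp
qed (use assms in simp)

text \<open>Two representatives agree far out, hence, comparing ancestors, wherever both are defined.\<close>

lemma moves_unique:
  assumes A: "A \<in> carrier N" and w: "moves A v w" and w': "moves A v w'"
  shows "w = w'"
proof -
  obtain \<psi> F F' where \<psi>: "(\<psi>, F, F') \<in> A" "v \<in> co F" "w = \<psi> v"
    using w by (auto simp: moves_def)
  obtain \<phi> E E' where \<phi>: "(\<phi>, E, E') \<in> A" "v \<in> co E" "w' = \<phi> v"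
    using w' by (auto simp: moves_def)
  have v: "v @ replicate k 0 \<in> V" for k
    using \<psi>(2) replicate_in_V by simp
  have desc: "\<exists>s. length s = k \<and> \<theta> (v @ replicate k 0) = \<theta> v @ s"
    if "(\<theta>, H, H') \<in> A" "v \<in> co H" for \<theta> H H' k
  proof -
    have t: "(\<theta>, H, H') \<in> triples" using neretin_rep(2)[OF A that(1)] .
    have "v @ replicate k 0 \<in> co H \<and> (\<exists>s. length s = k \<and> \<theta> (v @ replicate k 0) = \<theta> v @ s)"
    proof (induction k)
      case (Suc k)
      have "(v @ replicate k 0) @ [0] \<in> V"
        using v[of "Suc k"] by (simp flip: replicate_append_same)
      then have "(v @ replicate k 0) @ [0] \<in> co H"
        "\<exists>j. \<theta> ((v @ replicate k 0) @ [0]) = \<theta> (v @ replicate k 0) @ [j]"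
        using aa_triples_child[OF t] Suc by blast+
      then show ?case
        using Suc by (auto simp flip: replicate_append_same)
    qed (use that in simp)
    then show ?thesis by blast
  qed
  have "ev_eq \<psi> \<phi>"
    using germ_class_eqD neretin_rep(1)[OF A] \<psi>(1) \<phi>(1) by metis
  \<comment> \<open>Injectivity of the ray puts only finitely many of its points in the set of
    disagreement. At any other point both values extend \<open>w\<close> and \<open>w'\<close> by
    equally many entries, so these prefixes coincide.\<close>
  then have "finite ((\<lambda>k. v @ replicate k 0) -` {u \<in> V. \<psi> u \<noteq> \<phi> u})"
    unfolding ev_eq_def
    by (intro finite_vimageI) (auto intro!: injI dest: arg_cong[where f = length])
  then obtain k where "k \<notin> (\<lambda>k. v @ replicate k 0) -` {u \<in> V. \<psi> u \<noteq> \<phi> u}"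
    using ex_new_if_finite infinite_UNIV_nat by blast
  then have "\<psi> (v @ replicate k 0) = \<phi> (v @ replicate k 0)"
    using v by simp
  then show ?thesis
    using desc[OF \<psi>(1,2), of k] desc[OF \<phi>(1,2), of k] \<psi>(3) \<phi>(3) by (metis append_eq_append_conv)
qed

lemma moves_injective:
  "A \<in> carrier N \<Longrightarrow> moves A v w \<Longrightarrow> moves A v' w \<Longrightarrow> v = v'"
  using moves_unique[of "inv\<^bsub>N\<^esub> A"] moves_inv by (meson N.inv_closed)

text \<open>The complement of the union of the domains of all representatives; it lies inside the
  source set \<open>F\<close> of each of them.\<close>

definition bad_verts :: "aa_triple set \<Rightarrow> nat list set" where
  "bad_verts A = {v \<in> V. \<nexists>w. moves A v w}"

lemma moves_germ_class_eventually:
  assumes "A \<in> carrier N"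
  obtains \<psi> where "A = germ_class \<psi>" "finite {v \<in> V. \<not> moves A v (\<psi> v)}"
proof -
  obtain \<psi> F F' where \<psi>: "(\<psi>, F, F') \<in> A" "A = germ_class \<psi>" "(\<psi>, F, F') \<in> triples"
    using assms by (rule neretin_repE)
  have "{v \<in> V. \<not> moves A v (\<psi> v)} \<subseteq> F"
    using \<psi>(1) by (auto simp: moves_def)
  then have "finite {v \<in> V. \<not> moves A v (\<psi> v)}"
    using \<psi>(3) by (meson aa_triples_iff admissible_def finite_subset)
  then show ?thesis using \<psi> that by blast
qed

lemma admissible_bad_verts:
  assumes "A \<in> carrier N"
  shows "adm (bad_verts A)"
proof -
  obtain \<psi> where "finite {v \<in> V. \<not> moves A v (\<psi> v)}"
    using moves_germ_class_eventually[OF assms] by blast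
  then have "finite (bad_verts A)"
    by (rule finite_subset[rotated]) (auto simp: bad_verts_def)
  moreover have "u \<in> bad_verts A" if bad: "v \<in> bad_verts A" and uv: "is_child u v" for u v
  proof -
    obtain i where v: "v = u @ [i]" using uv by (auto simp: is_child_def)
    then have "u \<in> V" "\<not> moves A u w" for w
      using bad moves_child[OF assms, of u w i] by (auto simp: bad_verts_def snoc_in_V)
    then show ?thesis by (simp add: bad_verts_def)
  qed
  moreover have "bad_verts A \<subseteq> V"
    by (auto simp: bad_verts_def)
  ultimately show ?thesis
    unfolding admissible_def by blast
qed

text \<open>Extending by the identity on \<open>F\<close>.\<close>

lemma moves_co_roots_imp_aut:
  assumes A: "A \<in> carrier N" and F: "adm F" and fixed: "\<And>v. v \<in> rts F \<Longrightarrow> moves A v v"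
  obtains k where "k \<in> tree_aut d r" "A = aut_to_aa d r k" "\<And>v. v \<in> F \<Longrightarrow> k v = v"
proof -
  \<comment> \<open>Stated for any \<open>B\<close>, since surjectivity of \<open>m\<close> applies
    it to the inverse of \<open>A\<close>. A descendant of a root of the complement stays outside
    \<open>F\<close> because \<open>F\<close> is closed under prefixes.\<close>
  have step: "\<exists>w\<in>co F. moves B v w"
    if v: "v \<in> co F" and B: "B \<in> carrier N" and fixed: "\<And>v. v \<in> rts F \<Longrightarrow> moves B v v" for v B
  proof -
    obtain u s where u: "v = u @ s" "u \<in> rts F"
      using co_roots_prefix[OF F v] .
    then obtain s' where s': "moves B v (u @ s')"
      using moves_descendant[OF B fixed[OF u(2)], of s] v by auto
    have "u \<notin> F" using u(2) by (simp add: co_roots_iff[OF F])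
    then have "u @ s' \<notin> F" using admissible_prefix[OF F] by blast
    then show ?thesis using s' moves_in_V[OF B s'] by auto
  qed
  let ?B = "inv\<^bsub>N\<^esub> A"
  have B: "?B \<in> carrier N" using A by simp
  have fixed': "moves ?B v v" if "v \<in> rts F" for v
    using fixed[OF that] moves_inv[OF A] by blast
  have moves_B: "moves ?B v w \<longleftrightarrow> moves A w v" for v w
    using moves_inv[OF A] moves_inv[OF B] A by fastforce
  obtain m where m: "\<And>v. v \<in> co F \<Longrightarrow> m v \<in> co F \<and> moves A v (m v)"
    using step[OF _ A fixed] by metis
  have m_eq: "m v = w" if "v \<in> co F" "moves A v w" for v w
    using moves_unique[OF A] m that by blast
  define k where "k v = (if v \<in> V then if v \<in> F then v else m v else undefined)" for v
  have inj: "inj_on m (co F)"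
    using m moves_injective[OF A] by (metis inj_onI)
  have surj: "m ` co F = co F"
  proof -
    have "w \<in> m ` co F" if "w \<in> co F" for w
      using step[OF that B fixed'] m_eq moves_B by (metis image_eqI)
    then show ?thesis using m by blast
  qed
  have FV: "F \<subseteq> V" using F by (simp add: admissible_def)
  have "bij_betw k (F \<union> co F) (F \<union> co F)"
  proof (rule bij_betw_combine)
    show "bij_betw k F F"
      using FV by (auto simp: bij_betw_def inj_on_def k_def image_iff subset_iff)
    have "bij_betw m (co F) (co F)"
      using inj surj by (simp add: bij_betw_def)
    then show "bij_betw k (co F) (co F)"
      by (rule bij_betw_cong[THEN iffD1, rotated]) (simp add: k_def)
  qed auto
  moreover have "F \<union> co F = co {}" using FV by auto
  ultimately have bij: "bij_betw k (co {}) (co {})" by simp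
  have child: "is_child (k u) (k v) \<longleftrightarrow> is_child u v" if "u \<in> V" "v \<in> V" for u v
  proof -
    consider "u \<in> F" "v \<in> F" | "u \<notin> F" "v \<in> F" | "u \<in> F" "v \<notin> F" | "u \<notin> F" "v \<notin> F" by blast
    then show ?thesis
    proof cases
      case 1
      then show ?thesis using that by (simp add: k_def)
    next
      case 2
      then have "m u \<notin> F" using m that by simp
      then show ?thesis
        using F 2 that by (auto simp: k_def admissible_def)
    next
      case 3
      \<comment> \<open>A child outside \<open>F\<close> of a vertex in \<open>F\<close> is a root
        of the complement and hence fixed by \<open>A\<close>. This is used for \<open>v\<close>
        and, in the other direction, for \<open>m v\<close>.\<close>
      have root: "w \<in> rts F" if "w \<in> co F" "is_child u w" for w
        using that 3 is_child_unique by (auto simp: co_roots_iff[OF F])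
      have mv: "m v \<in> co F" "moves A v (m v)" using m 3 that by auto
      have "m v = v" if "is_child u v"
        using root[of v] that 3 \<open>v \<in> V\<close> fixed m_eq by simp
      moreover have "m v = v" if "is_child u (m v)"
        using root[OF mv(1) that] fixed mv(2) moves_injective[OF A] by metis
      ultimately show ?thesis
        using that 3 by (auto simp: k_def)
    next
      case 4
      have mu: "m u \<in> co F" "moves A u (m u)" and mv: "m v \<in> co F" "moves A v (m v)"
        using m 4 that by auto
      have "is_child (m u) (m v)" if "is_child u v"
        using that moves_child[OF A mu(2)] \<open>v \<in> V\<close> m_eq[of v] 4 by (auto simp: is_child_def)
      \<comment> \<open>The inverse of \<open>A\<close> carries the child \<open>m v\<close> of
        \<open>m u\<close> to a child of \<open>u\<close>, and by uniqueness that child is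
        \<open>v\<close>.\<close>
      moreover have "is_child u v" if mm: "is_child (m u) (m v)"
      proof -
        obtain i where i: "m v = m u @ [i]" using mm by (auto simp: is_child_def)
        then obtain j where "moves ?B (m v) (u @ [j])"
          using moves_child[OF B, of "m u" u i] mu mv moves_B by auto
        then show ?thesis
          using mv(2) moves_B moves_unique[OF B] by (metis is_child_append)
      qed
      ultimately show ?thesis
        using that 4 by (auto simp: k_def)
    qed
  qed
  have k: "k \<in> tree_aut d r"
    using bij child by (auto simp: tree_aut_iff aa_triples_iff extensional_def k_def)
  obtain \<psi> where \<psi>: "A = germ_class \<psi>" "finite {v \<in> V. \<not> moves A v (\<psi> v)}"
    using moves_germ_class_eventually[OF A] .
  have "ev_eq \<psi> k"
  proof (rule ev_eqI)
    show "finite (F \<union> {v \<in> V. \<not> moves A v (\<psi> v)})"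
      using F \<psi>(2) by (simp add: admissible_def)
    show "\<psi> v = k v" if "v \<in> V" "v \<notin> F \<union> {v \<in> V. \<not> moves A v (\<psi> v)}" for v
      using that m_eq[of v "\<psi> v"] by (simp add: k_def)
  qed
  then have "A = aut_to_aa d r k"
    using \<psi>(1) aut_to_aa_eq[OF k] germ_class_cong by simp
  moreover have "k v = v" if "v \<in> F" for v
    using that FV by (auto simp: k_def)
  ultimately show ?thesis using k that by blast
qed

end

section \<open>The topology\<close>

context tree_params
begin

section \<open>Neighbourhoods in the automorphism group and its compactness\<close>

lemma tree_aut_length:
  assumes "k \<in> tree_aut d r" "v \<in> V"
  shows "length (k v) = length v"
  using assms(2)
proof (induction v rule: rev_induct)
  case Nil
  have "k ` rts {} = rts {}"
    using assms(1) by (simp add: tree_aut_def forest_iso_def)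
  then show ?case by (simp add: co_roots_empty)
next
  case (snoc i v)
  then have "is_child (k v) (k (v @ [i]))"
    using assms(1) by (auto simp: tree_aut_iff aa_triples_iff snoc_in_V)
  then show ?case
    using snoc by (auto simp: is_child_length snoc_in_V)
qed

text \<open>Basic open sets of the product constrain finitely many coordinates, and every finite set
  of vertices lies in a ball, so agreement on balls gives a neighbourhood basis.\<close>

lemma openin_tree_aut_topology:
  "openin (tree_aut_topology d r) U \<longleftrightarrow> U \<subseteq> tree_aut d r \<and>
    (\<forall>k\<in>U. \<exists>n. \<forall>l\<in>tree_aut d r. (\<forall>v\<in>tree_ball n. l v = k v) \<longrightarrow> l \<in> U)"
  (is "?L \<longleftrightarrow> ?R")
proof
  let ?P = "product_topology (\<lambda>_. discrete_topology V) V"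
  have ext: "l \<in> (\<Pi>\<^sub>E v\<in>V. V)" if "l \<in> tree_aut d r" for l
    using that aa_triples_image[of l "{}" "{}"]
    by (simp add: tree_aut_iff aa_triples_iff co_verts_def PiE_iff)
  {
    assume ?L
    then obtain W where W: "openin ?P W" "U = W \<inter> tree_aut d r"
      by (auto simp: tree_aut_topology_def openin_subtopology)
    have "\<exists>n. \<forall>l\<in>tree_aut d r. (\<forall>v\<in>tree_ball n. l v = k v) \<longrightarrow> l \<in> U" if k: "k \<in> U" for k
    proof -
      obtain B where B: "finite {v \<in> V. B v \<noteq> V}" "k \<in> PiE V B" "PiE V B \<subseteq> W"
        using W k unfolding openin_product_topology_alt by (auto simp: topspace_discrete_topology)
      obtain n where n: "{v \<in> V. B v \<noteq> V} \<subseteq> tree_ball n"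
        using finite_set_in_tree_ball[OF B(1)] by blast
      have "l \<in> U" if l: "l \<in> tree_aut d r" and eq: "\<forall>v\<in>tree_ball n. l v = k v" for l
      proof -
        have "l v \<in> B v" if v: "v \<in> V" for v
        proof (cases "B v = V")
          case True
          then show ?thesis using ext[OF l] v by auto
        next
          case False
          then have "l v = k v" using n v eq by blast
          then show ?thesis using B(2) v by auto
        qed
        then have "l \<in> PiE V B" using ext[OF l] by (auto simp: PiE_iff)
        then show ?thesis using B(3) W(2) l by blast
      qed
      then show ?thesis by blast
    qed
    then show ?R using W(2) by blast
  }
  assume R: ?R
  show ?L
    unfolding openin_subopen[of _ U]
  proof
    fix k assume k: "k \<in> U"
    then obtain n where n: "\<forall>l\<in>tree_aut d r. (\<forall>v\<in>tree_ball n. l v = k v) \<longrightarrow> l \<in> U"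
      using R by blast
    let ?B = "\<lambda>v. if v \<in> tree_ball n then {k v} else V"
    have k': "k \<in> tree_aut d r" using R k by blast
    have "finite {v \<in> V. ?B v \<noteq> V}"
      by (rule finite_subset[OF _ finite_tree_ball[of n]]) auto
    then have "openin ?P (PiE V ?B)"
      using ext[OF k'] by (auto simp: openin_PiE_gen)
    then have "openin (tree_aut_topology d r) (PiE V ?B \<inter> tree_aut d r)"
      unfolding tree_aut_topology_def openin_subtopology by blast
    moreover have "k \<in> PiE V ?B \<inter> tree_aut d r"
      using ext[OF k'] k' by (auto simp: PiE_iff)
    moreover have "PiE V ?B \<inter> tree_aut d r \<subseteq> U"
    proof
      fix l assume l: "l \<in> PiE V ?B \<inter> tree_aut d r"
      have "l v = k v" if "v \<in> tree_ball n" for v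
      proof -
        have "v \<in> V" using that by (simp add: tree_ball_def)
        then have "l v \<in> ?B v" by (rule PiE_mem[OF IntD1[OF l]])
        then show ?thesis using that by simp
      qed
      then show "l \<in> U" using n l by blast
    qed
    ultimately show "\<exists>T. openin (tree_aut_topology d r) T \<and> k \<in> T \<and> T \<subseteq> U" by blast
  qed
qed

lemma topspace_tree_aut_topology [simp]: "topspace (tree_aut_topology d r) = tree_aut d r"
proof
  have "openin (tree_aut_topology d r) (tree_aut d r)"
    by (simp add: openin_tree_aut_topology)
  then show "tree_aut d r \<subseteq> topspace (tree_aut_topology d r)"
    by (rule openin_subset)
qed (simp add: tree_aut_topology_def)

text \<open>Automorphisms preserve length, so they lie in a product of finite spheres, compact by
  Tychonoff. Among its elements they are cut out by conditions on two coordinates at a time, which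
  are closed in a product of discrete spaces.\<close>

lemma compact_space_tree_aut_topology: "compact_space (tree_aut_topology d r)"
proof -
  let ?P = "product_topology (\<lambda>_. discrete_topology V) V"
  let ?L = "\<lambda>v. {w \<in> V. length w = length v}"
  have fin: "finite (?L v)" for v
    by (rule finite_subset[OF _ finite_tree_ball[of "length v"]]) (auto simp: tree_ball_def)
  have "openin ?P {g \<in> topspace ?P. Q (g u) (g v)}" if "u \<in> V" "v \<in> V" for Q u v
  proof -
    have op: "openin ?P {g \<in> topspace ?P. g u \<in> A}" if "u \<in> V" "A \<subseteq> V" for A u
      using that by (intro openin_continuous_map_preimage[OF continuous_map_product_projection]) auto
    have "{g \<in> topspace ?P. Q (g u) (g v)} =
        (\<Union>a\<in>V. {g \<in> topspace ?P. g u \<in> {a}} \<inter> {g \<in> topspace ?P. g v \<in> {b \<in> V. Q a b}})"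
      using that by (auto simp: PiE_iff)
    moreover have "openin ?P ({g \<in> topspace ?P. g u \<in> {a}} \<inter> {g \<in> topspace ?P. g v \<in> {b \<in> V. Q a b}})"
      if "a \<in> V" for a
      using op[OF \<open>u \<in> V\<close>, of "{a}"] op[OF \<open>v \<in> V\<close>, of "{b \<in> V. Q a b}"] that
      by (intro openin_Int) auto
    then have "openin ?P (\<Union>a\<in>V. {g \<in> topspace ?P. g u \<in> {a}} \<inter> {g \<in> topspace ?P. g v \<in> {b \<in> V. Q a b}})"
      by (intro openin_Union) (elim imageE, simp only:)
    ultimately show ?thesis by simp
  qed
  note op = this
  have cl: "closedin ?P {g \<in> topspace ?P. Q (g u) (g v)}" if "u \<in> V" "v \<in> V" for Q u v
  proof -
    have "topspace ?P - {g \<in> topspace ?P. Q (g u) (g v)} =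
        {g \<in> topspace ?P. \<not> Q (g u) (g v)}" by blast
    then show ?thesis
      using op[OF that, of "\<lambda>a b. \<not> Q a b"] unfolding closedin_def by auto
  qed
  \<comment> \<open>Injectivity and compatibility with children involve only pairs of vertices.
    Surjectivity is not of this kind and is recovered below.\<close>
  let ?Q = "\<lambda>u v a b. (a = b \<longrightarrow> u = v) \<and> (is_child a b \<longleftrightarrow> is_child u v)"
  define C where "C = (\<Inter>(u, v)\<in>V \<times> V. {g \<in> topspace ?P. ?Q u v (g u) (g v)})"
  have "V \<times> V \<noteq> {}" using nil_in_V by blast
  then have "closedin ?P C"
    unfolding C_def by (rule closedin_INT) (use cl in auto)
  moreover have "compactin ?P (PiE V ?L)"
    unfolding compactin_PiE using fin by (auto simp: compactin_discrete_topology)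
  ultimately have comp: "compactin ?P (PiE V ?L \<inter> C)"
    by (subst Int_commute) (rule closed_Int_compactin)
  have "tree_aut d r = PiE V ?L \<inter> C"
  proof
    show "tree_aut d r \<subseteq> PiE V ?L \<inter> C"
    proof
      fix k assume k: "k \<in> tree_aut d r"
      have t: "(k, {}, {}) \<in> triples" using k by (simp add: tree_aut_iff)
      have "k \<in> extensional V" "inj_on k V"
        "\<And>u v. u \<in> V \<Longrightarrow> v \<in> V \<Longrightarrow> is_child (k u) (k v) \<longleftrightarrow> is_child u v"
        using t by (auto simp: aa_triples_iff co_verts_def bij_betw_def)
      moreover have "k v \<in> V" if "v \<in> V" for v
        using aa_triples_image[OF t, of v] that by simp
      ultimately show "k \<in> PiE V ?L \<inter> C"
        using tree_aut_length[OF k] by (auto simp: C_def PiE_iff inj_on_def)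
    qed
    show "PiE V ?L \<inter> C \<subseteq> tree_aut d r"
    proof
      fix k assume k: "k \<in> PiE V ?L \<inter> C"
      have inj: "inj_on k V"
        and child: "\<And>u v. u \<in> V \<Longrightarrow> v \<in> V \<Longrightarrow> is_child (k u) (k v) \<longleftrightarrow> is_child u v"
        using k by (auto simp: C_def inj_on_def)
      have lv: "k v \<in> ?L v" if "v \<in> V" for v
        using k that by (auto simp: PiE_iff)
      \<comment> \<open>Surjectivity follows level by level: an injective map of a finite sphere
        into itself is onto.\<close>
      have "w \<in> k ` V" if "w \<in> V" for w
      proof -
        have "k ` ?L w = ?L w"
          using lv by (intro endo_inj_surj fin inj_on_subset[OF inj]) auto
        then show ?thesis using that by blast
      qed
      then have "bij_betw k V V"
        using inj lv by (auto simp: bij_betw_def)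
      then show "k \<in> tree_aut d r"
        using k child by (auto simp: tree_aut_iff aa_triples_iff co_verts_def PiE_iff)
    qed
  qed
  then show ?thesis
    using compact_space_subtopology[OF comp] by (simp add: tree_aut_topology_def)
qed

text \<open>The image in the Neretin group of the pointwise stabilizer of the ball of radius \<open>n\<close>.\<close>

definition ball_stab :: "nat \<Rightarrow> aa_triple set set" where
  "ball_stab n = {A \<in> carrier N. \<forall>v\<in>tree_ball n. moves A v v}"

lemma ball_stab_carrier: "A \<in> ball_stab n \<Longrightarrow> A \<in> carrier N"
  by (simp add: ball_stab_def)

lemma one_ball_stab [simp]: "\<one>\<^bsub>N\<^esub> \<in> ball_stab n"
  by (simp add: ball_stab_def moves_one tree_ball_def)

lemma mult_ball_stab: "A \<in> ball_stab n \<Longrightarrow> B \<in> ball_stab n \<Longrightarrow> A \<otimes>\<^bsub>N\<^esub> B \<in> ball_stab n"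
  by (auto simp: ball_stab_def intro: moves_mult)

lemma inv_ball_stab: "A \<in> ball_stab n \<Longrightarrow> inv\<^bsub>N\<^esub> A \<in> ball_stab n"
  by (auto simp: ball_stab_def intro: moves_inv)

lemma ball_stab_antimono: "m \<le> n \<Longrightarrow> ball_stab n \<subseteq> ball_stab m"
  using tree_ball_mono by (auto simp: ball_stab_def)

lemma aut_to_aa_moves_iff:
  "k \<in> tree_aut d r \<Longrightarrow> v \<in> V \<Longrightarrow> moves (aut_to_aa d r k) v w \<longleftrightarrow> w = k v"
  using moves_aut moves_unique[OF aut_to_aa_carrier] by blast

text \<open>Every ball contains \<open>[]\<close>, the only root of the complement of the empty set,
  so \<open>moves_co_roots_imp_aut\<close> applies with \<open>F = {}\<close>.\<close>

lemma ball_stab_aut: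
  assumes "A \<in> ball_stab n"
  obtains k where "k \<in> tree_aut d r" "A = aut_to_aa d r k"
proof -
  have "[] \<in> tree_ball n" by (simp add: tree_ball_def)
  then have "moves A [] []" using assms by (simp add: ball_stab_def)
  then show ?thesis
    using moves_co_roots_imp_aut[OF ball_stab_carrier[OF assms] admissible_empty] that
    by (auto simp: co_roots_empty)
qed

lemma ball_stab_eq:
  "ball_stab n = aut_to_aa d r ` {k \<in> tree_aut d r. \<forall>v\<in>tree_ball n. k v = v}"
proof
  show "ball_stab n \<subseteq> aut_to_aa d r ` {k \<in> tree_aut d r. \<forall>v\<in>tree_ball n. k v = v}"
  proof
    fix A assume A: "A \<in> ball_stab n"
    then obtain k where k: "k \<in> tree_aut d r" "A = aut_to_aa d r k"
      by (rule ball_stab_aut)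
    have "k v = v" if "v \<in> tree_ball n" for v
      using A that aut_to_aa_moves_iff[OF k(1), of v v] by (auto simp: ball_stab_def k(2) tree_ball_def)
    then show "A \<in> aut_to_aa d r ` {k \<in> tree_aut d r. \<forall>v\<in>tree_ball n. k v = v}"
      using k by blast
  qed
qed (auto simp: ball_stab_def aut_to_aa_carrier aut_to_aa_moves_iff tree_ball_def)

text \<open>The ball of radius 0 is just the root, which every tree automorphism fixes. Cosets of
  the full automorphism group are therefore the case \<open>n = 0\<close> of the cosets
  below.\<close>

lemma ball_stab_0: "ball_stab 0 = aut_to_aa d r ` tree_aut d r"
proof -
  have "k v = v" if "k \<in> tree_aut d r" "v \<in> tree_ball 0" for k v
    using tree_aut_length[OF that(1), of v] that(2) by (simp add: tree_ball_def)
  then show ?thesis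
    unfolding ball_stab_eq by (intro arg_cong[where f = "\<lambda>S. aut_to_aa d r ` S"]) blast
qed

lemma mult_inv_mult:
  "A \<in> carrier N \<Longrightarrow> B \<in> carrier N \<Longrightarrow> A \<otimes>\<^bsub>N\<^esub> (inv\<^bsub>N\<^esub> A \<otimes>\<^bsub>N\<^esub> B) = B"
  by (simp flip: N.m_assoc)

text \<open>The dictionary between the two topologies: agreement on a ball among automorphisms is
  membership in a common left coset. Continuity and openness of the inclusion both follow from
  it.\<close>

lemma aut_to_aa_diff_ball_stab:
  assumes k: "k \<in> tree_aut d r" and l: "l \<in> tree_aut d r"
  shows "inv\<^bsub>N\<^esub> (aut_to_aa d r k) \<otimes>\<^bsub>N\<^esub> aut_to_aa d r l \<in> ball_stab n \<longleftrightarrow>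
    (\<forall>v\<in>tree_ball n. l v = k v)"
proof -
  let ?k = "aut_to_aa d r k" and ?l = "aut_to_aa d r l"
  have carr: "?k \<in> carrier N" "?l \<in> carrier N" using k l by (simp_all add: aut_to_aa_carrier)
  have "moves (inv\<^bsub>N\<^esub> ?k \<otimes>\<^bsub>N\<^esub> ?l) v v \<longleftrightarrow> l v = k v" if v: "v \<in> V" for v
  proof
    assume "l v = k v"
    then show "moves (inv\<^bsub>N\<^esub> ?k \<otimes>\<^bsub>N\<^esub> ?l) v v"
      using moves_mult[OF _ carr(2) moves_aut[OF l v], of "inv\<^bsub>N\<^esub> ?k" v]
        moves_inv[OF carr(1) moves_aut[OF k v]] carr by simp
  next
    assume "moves (inv\<^bsub>N\<^esub> ?k \<otimes>\<^bsub>N\<^esub> ?l) v v"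
    then have "moves (?k \<otimes>\<^bsub>N\<^esub> (inv\<^bsub>N\<^esub> ?k \<otimes>\<^bsub>N\<^esub> ?l)) v (k v)"
      using carr moves_mult[OF _ _ _ moves_aut[OF k v], of "inv\<^bsub>N\<^esub> ?k \<otimes>\<^bsub>N\<^esub> ?l" v] by simp
    then have "moves ?l v (k v)"
      using carr by (simp add: mult_inv_mult)
    then show "l v = k v"
      using aut_to_aa_moves_iff[OF l v] by simp
  qed
  then show ?thesis
    using carr by (auto simp: ball_stab_def tree_ball_def)
qed

text \<open>Take a ball containing the ball of radius \<open>n\<close> and all bad vertices of
  \<open>A\<close>. If \<open>B\<close> fixes the finitely many \<open>A\<close>-images of the roots
  of its complement, the conjugate fixes those roots, and so is an automorphism trivial on the
  ball.\<close>

lemma conj_ball_stab: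
  assumes A: "A \<in> carrier N"
  shows "\<exists>m. \<forall>B\<in>ball_stab m. inv\<^bsub>N\<^esub> A \<otimes>\<^bsub>N\<^esub> B \<otimes>\<^bsub>N\<^esub> A \<in> ball_stab n"
proof -
  have "finite (bad_verts A)" "bad_verts A \<subseteq> V"
    using admissible_bad_verts[OF A] by (auto simp: admissible_def)
  then obtain n1 where n1: "bad_verts A \<subseteq> tree_ball n1"
    by (rule finite_set_in_tree_ball)
  define p where "p = max n n1"
  let ?F = "tree_ball p"
  note F = admissible_tree_ball[of p]
  have rts: "v \<in> tree_ball (Suc p)" "v \<notin> bad_verts A" if "v \<in> rts ?F" for v
  proof -
    have v: "v \<in> V" "v \<notin> ?F" "\<And>u. is_child u v \<Longrightarrow> u \<in> ?F"
      using that by (simp_all add: co_roots_iff[OF F])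
    then show "v \<notin> bad_verts A"
      using n1 tree_ball_mono[of n1 p] by (auto simp: p_def)
    show "v \<in> tree_ball (Suc p)"
      using v(1,3) by (cases v rule: rev_cases) (auto simp: tree_ball_def)
  qed
  \<comment> \<open>The roots of the complement of the ball of radius \<open>p\<close> lie at depth
    \<open>p + 1\<close>. By \<open>moves_unique\<close> their images form the image of a finite set
    under a function.\<close>
  let ?W = "{w. \<exists>v\<in>tree_ball (Suc p). moves A v w}"
  have "?W \<subseteq> (\<lambda>v. THE w. moves A v w) ` tree_ball (Suc p)"
    using moves_unique[OF A] by (auto intro!: image_eqI the_equality[symmetric])
  then have "finite ?W"
    using finite_tree_ball by (meson finite_imageI finite_subset)
  moreover have "?W \<subseteq> V"
    using moves_in_V[OF A] by blast
  ultimately obtain m where m: "?W \<subseteq> tree_ball m"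
    by (rule finite_set_in_tree_ball)
  have "inv\<^bsub>N\<^esub> A \<otimes>\<^bsub>N\<^esub> B \<otimes>\<^bsub>N\<^esub> A \<in> ball_stab n" if B: "B \<in> ball_stab m" for B
  proof -
    have Bc: "B \<in> carrier N" using B by (rule ball_stab_carrier)
    have "moves (inv\<^bsub>N\<^esub> A \<otimes>\<^bsub>N\<^esub> B \<otimes>\<^bsub>N\<^esub> A) v v" if v: "v \<in> rts ?F" for v
    proof -
      have "v \<in> V" using rts(1)[OF v] by (simp add: tree_ball_def)
      then obtain w where w: "moves A v w"
        using rts(2)[OF v] by (auto simp: bad_verts_def)
      then have "w \<in> tree_ball m" using m rts(1)[OF v] by blast
      then have "moves B w w" using B by (simp add: ball_stab_def)
      then show ?thesis
        using A Bc w moves_inv[OF A w] by (intro moves_mult) auto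
    qed
    moreover have "inv\<^bsub>N\<^esub> A \<otimes>\<^bsub>N\<^esub> B \<otimes>\<^bsub>N\<^esub> A \<in> carrier N" using A Bc by simp
    ultimately obtain k where k: "k \<in> tree_aut d r" "inv\<^bsub>N\<^esub> A \<otimes>\<^bsub>N\<^esub> B \<otimes>\<^bsub>N\<^esub> A = aut_to_aa d r k"
      "\<And>v. v \<in> ?F \<Longrightarrow> k v = v"
      using moves_co_roots_imp_aut[OF _ F] by blast
    then show ?thesis
      using tree_ball_mono[of n p] by (auto simp: ball_stab_eq p_def)
  qed
  then show ?thesis by blast
qed

section \<open>The coset topology and its compatibility with the group law\<close>

definition coset_open :: "aa_triple set set \<Rightarrow> bool" where
  "coset_open U \<longleftrightarrow> U \<subseteq> carrier N \<and>
    (\<forall>A\<in>U. \<exists>n. \<forall>B\<in>carrier N. inv\<^bsub>N\<^esub> A \<otimes>\<^bsub>N\<^esub> B \<in> ball_stab n \<longrightarrow> B \<in> U)"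

definition coset_topology :: "aa_triple set topology" where
  "coset_topology = topology coset_open"

lemma istopology_coset_open: "istopology coset_open"
  unfolding istopology_def
proof (intro conjI allI impI)
  fix S T assume S: "coset_open S" and T: "coset_open T"
  show "coset_open (S \<inter> T)"
    unfolding coset_open_def
  proof (intro conjI ballI)
    show "S \<inter> T \<subseteq> carrier N" using S by (auto simp: coset_open_def)
    fix A assume "A \<in> S \<inter> T"
    then obtain m n where
      m: "\<forall>B\<in>carrier N. inv\<^bsub>N\<^esub> A \<otimes>\<^bsub>N\<^esub> B \<in> ball_stab m \<longrightarrow> B \<in> S" and
      n: "\<forall>B\<in>carrier N. inv\<^bsub>N\<^esub> A \<otimes>\<^bsub>N\<^esub> B \<in> ball_stab n \<longrightarrow> B \<in> T"
      using S T unfolding coset_open_def by blast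
    have "ball_stab (max m n) \<subseteq> ball_stab m \<inter> ball_stab n"
      using ball_stab_antimono by simp
    then show "\<exists>n. \<forall>B\<in>carrier N. inv\<^bsub>N\<^esub> A \<otimes>\<^bsub>N\<^esub> B \<in> ball_stab n \<longrightarrow> B \<in> S \<inter> T"
      using m n by blast
  qed
next
  fix \<U> assume "\<forall>U\<in>\<U>. coset_open U"
  then show "coset_open (\<Union> \<U>)"
    unfolding coset_open_def by (meson Sup_least UnionE UnionI)
qed

lemma openin_coset_topology: "openin coset_topology = coset_open"
  by (simp add: coset_topology_def istopology_coset_open)

lemma topspace_coset_topology [simp]: "topspace coset_topology = carrier N"
proof
  have "openin coset_topology (carrier N)"
    by (simp add: openin_coset_topology coset_open_def)
  then show "carrier N \<subseteq> topspace coset_topology" by (rule openin_subset)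
  show "topspace coset_topology \<subseteq> carrier N"
    using openin_topspace[of coset_topology] by (simp add: openin_coset_topology coset_open_def)
qed

lemma inv_mult_cancel:
  assumes "A \<in> carrier N" "B \<in> carrier N" "C \<in> carrier N"
  shows "(inv\<^bsub>N\<^esub> A \<otimes>\<^bsub>N\<^esub> B) \<otimes>\<^bsub>N\<^esub> (inv\<^bsub>N\<^esub> B \<otimes>\<^bsub>N\<^esub> C) = inv\<^bsub>N\<^esub> A \<otimes>\<^bsub>N\<^esub> C"
  using assms by (simp add: N.m_assoc mult_inv_mult)

lemma coset_open_coset:
  assumes "A \<in> carrier N"
  shows "coset_open {B \<in> carrier N. inv\<^bsub>N\<^esub> A \<otimes>\<^bsub>N\<^esub> B \<in> ball_stab n}"
  unfolding coset_open_def
proof (intro conjI ballI)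
  fix B assume B: "B \<in> {B \<in> carrier N. inv\<^bsub>N\<^esub> A \<otimes>\<^bsub>N\<^esub> B \<in> ball_stab n}"
  have "inv\<^bsub>N\<^esub> A \<otimes>\<^bsub>N\<^esub> C \<in> ball_stab n"
    if "C \<in> carrier N" "inv\<^bsub>N\<^esub> B \<otimes>\<^bsub>N\<^esub> C \<in> ball_stab n" for C
    using mult_ball_stab[OF _ that(2), of "inv\<^bsub>N\<^esub> A \<otimes>\<^bsub>N\<^esub> B"] B inv_mult_cancel[OF assms _ that(1), of B]
    by simp
  then show "\<exists>n'. \<forall>C\<in>carrier N. inv\<^bsub>N\<^esub> B \<otimes>\<^bsub>N\<^esub> C \<in> ball_stab n' \<longrightarrow>
      C \<in> {B \<in> carrier N. inv\<^bsub>N\<^esub> A \<otimes>\<^bsub>N\<^esub> B \<in> ball_stab n}" by blast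
qed blast

text \<open>For a topology given by left cosets of a filtering family of subgroups, continuity of
  both operations comes down to conjugation carrying a small subgroup into a given one, which is
  \<open>conj_ball_stab\<close>.\<close>

lemma topological_group_coset_topology: "topological_group N coset_topology"
  unfolding topological_group_def
proof (intro conjI)
  show "group N" by (rule group_neretin)
  show "topspace coset_topology = carrier N" by simp
  show "continuous_map (prod_topology coset_topology coset_topology) coset_topology
      (\<lambda>(x, y). x \<otimes>\<^bsub>N\<^esub> y)"
    unfolding continuous_map_def
  proof (intro conjI allI impI)
    fix U assume U: "openin coset_topology U"
    show "openin (prod_topology coset_topology coset_topology)
        {p \<in> topspace (prod_topology coset_topology coset_topology). (case p of (x, y) \<Rightarrow> x \<otimes>\<^bsub>N\<^esub> y) \<in> U}"
      unfolding openin_prod_topology_alt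
    proof (intro allI impI)
      fix A B assume "(A, B) \<in> {p \<in> topspace (prod_topology coset_topology coset_topology).
        (case p of (x, y) \<Rightarrow> x \<otimes>\<^bsub>N\<^esub> y) \<in> U}"
      then have A: "A \<in> carrier N" and B: "B \<in> carrier N" and AB: "A \<otimes>\<^bsub>N\<^esub> B \<in> U" by auto
      obtain n where n: "\<And>C. C \<in> carrier N \<Longrightarrow> inv\<^bsub>N\<^esub> (A \<otimes>\<^bsub>N\<^esub> B) \<otimes>\<^bsub>N\<^esub> C \<in> ball_stab n \<Longrightarrow> C \<in> U"
        using U AB unfolding openin_coset_topology coset_open_def by blast
      obtain m where m: "\<forall>C\<in>ball_stab m. inv\<^bsub>N\<^esub> B \<otimes>\<^bsub>N\<^esub> C \<otimes>\<^bsub>N\<^esub> B \<in> ball_stab n"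
        using conj_ball_stab[OF B] by blast
      let ?S = "{A' \<in> carrier N. inv\<^bsub>N\<^esub> A \<otimes>\<^bsub>N\<^esub> A' \<in> ball_stab m}"
      let ?T = "{B' \<in> carrier N. inv\<^bsub>N\<^esub> B \<otimes>\<^bsub>N\<^esub> B' \<in> ball_stab n}"
      have "A' \<otimes>\<^bsub>N\<^esub> B' \<in> U" if "A' \<in> ?S" "B' \<in> ?T" for A' B'
      proof (rule n)
        have carr: "A' \<in> carrier N" "B' \<in> carrier N" using that by auto
        then show "A' \<otimes>\<^bsub>N\<^esub> B' \<in> carrier N" by simp
        \<comment> \<open>The deviation of \<open>A'\<close> from \<open>A\<close> is conjugated by
          \<open>B\<close> before it meets the deviation of \<open>B'\<close> from \<open>B\<close>;
          this is why \<open>?S\<close> uses \<open>m\<close> and \<open>?T\<close> uses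
          \<open>n\<close>.\<close>
        have "inv\<^bsub>N\<^esub> (A \<otimes>\<^bsub>N\<^esub> B) \<otimes>\<^bsub>N\<^esub> (A' \<otimes>\<^bsub>N\<^esub> B') =
            (inv\<^bsub>N\<^esub> B \<otimes>\<^bsub>N\<^esub> (inv\<^bsub>N\<^esub> A \<otimes>\<^bsub>N\<^esub> A') \<otimes>\<^bsub>N\<^esub> B) \<otimes>\<^bsub>N\<^esub> (inv\<^bsub>N\<^esub> B \<otimes>\<^bsub>N\<^esub> B')"
          using A B carr by (simp add: N.inv_mult_group N.m_assoc mult_inv_mult)
        moreover have "inv\<^bsub>N\<^esub> B \<otimes>\<^bsub>N\<^esub> (inv\<^bsub>N\<^esub> A \<otimes>\<^bsub>N\<^esub> A') \<otimes>\<^bsub>N\<^esub> B \<in> ball_stab n"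
          using that m by blast
        ultimately show "inv\<^bsub>N\<^esub> (A \<otimes>\<^bsub>N\<^esub> B) \<otimes>\<^bsub>N\<^esub> (A' \<otimes>\<^bsub>N\<^esub> B') \<in> ball_stab n"
          using that(2) mult_ball_stab by simp
      qed
      then have "?S \<times> ?T \<subseteq> {p \<in> topspace (prod_topology coset_topology coset_topology).
          (case p of (x, y) \<Rightarrow> x \<otimes>\<^bsub>N\<^esub> y) \<in> U}"
        by auto
      moreover have "openin coset_topology ?S" "openin coset_topology ?T"
        using A B by (simp_all add: openin_coset_topology coset_open_coset)
      moreover have "A \<in> ?S" "B \<in> ?T" using A B by simp_all
      ultimately show "\<exists>S T. openin coset_topology S \<and> openin coset_topology T \<and> A \<in> S \<and> B \<in> T \<and>
          S \<times> T \<subseteq> {p \<in> topspace (prod_topology coset_topology coset_topology).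
            (case p of (x, y) \<Rightarrow> x \<otimes>\<^bsub>N\<^esub> y) \<in> U}"
        by (intro exI[of _ ?S] exI[of _ ?T] conjI)
    qed
  qed auto
  show "continuous_map coset_topology coset_topology (\<lambda>x. inv\<^bsub>N\<^esub> x)"
    unfolding continuous_map_def
  proof (intro conjI allI impI)
    fix U assume U: "openin coset_topology U"
    show "openin coset_topology {A \<in> topspace coset_topology. inv\<^bsub>N\<^esub> A \<in> U}"
      unfolding openin_coset_topology coset_open_def
    proof (intro conjI ballI)
      fix A assume "A \<in> {A \<in> topspace coset_topology. inv\<^bsub>N\<^esub> A \<in> U}"
      then have A: "A \<in> carrier N" "inv\<^bsub>N\<^esub> A \<in> U" by auto
      obtain n where n: "\<And>C. C \<in> carrier N \<Longrightarrow> inv\<^bsub>N\<^esub> (inv\<^bsub>N\<^esub> A) \<otimes>\<^bsub>N\<^esub> C \<in> ball_stab n \<Longrightarrow> C \<in> U"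
        using U A unfolding openin_coset_topology coset_open_def by blast
      have iA: "inv\<^bsub>N\<^esub> A \<in> carrier N" using A by simp
      obtain m where m: "\<forall>C\<in>ball_stab m. inv\<^bsub>N\<^esub> (inv\<^bsub>N\<^esub> A) \<otimes>\<^bsub>N\<^esub> C \<otimes>\<^bsub>N\<^esub> inv\<^bsub>N\<^esub> A \<in> ball_stab n"
        using conj_ball_stab[OF iA] by blast
      have "inv\<^bsub>N\<^esub> B \<in> U" if B: "B \<in> carrier N" "inv\<^bsub>N\<^esub> A \<otimes>\<^bsub>N\<^esub> B \<in> ball_stab m" for B
      proof (rule n)
        show "inv\<^bsub>N\<^esub> B \<in> carrier N" using B by simp
        \<comment> \<open>Inversion turns a left deviation into the inverse of its conjugate by
          \<open>inv A\<close>, again controlled by the choice of \<open>m\<close>.\<close>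
        have "inv\<^bsub>N\<^esub> (inv\<^bsub>N\<^esub> A) \<otimes>\<^bsub>N\<^esub> inv\<^bsub>N\<^esub> B =
            inv\<^bsub>N\<^esub> (inv\<^bsub>N\<^esub> (inv\<^bsub>N\<^esub> A) \<otimes>\<^bsub>N\<^esub> (inv\<^bsub>N\<^esub> A \<otimes>\<^bsub>N\<^esub> B) \<otimes>\<^bsub>N\<^esub> inv\<^bsub>N\<^esub> A)"
          using A B by (simp add: N.inv_mult_group flip: N.m_assoc)
        then show "inv\<^bsub>N\<^esub> (inv\<^bsub>N\<^esub> A) \<otimes>\<^bsub>N\<^esub> inv\<^bsub>N\<^esub> B \<in> ball_stab n"
          using m B(2) inv_ball_stab by metis
      qed
      then show "\<exists>n. \<forall>B\<in>carrier N. inv\<^bsub>N\<^esub> A \<otimes>\<^bsub>N\<^esub> B \<in> ball_stab n \<longrightarrow>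
          B \<in> {A \<in> topspace coset_topology. inv\<^bsub>N\<^esub> A \<in> U}" by auto
    qed auto
  qed auto
qed

lemma continuous_map_aut_to_aa:
  "continuous_map (tree_aut_topology d r) coset_topology (aut_to_aa d r)"
  unfolding continuous_map_def
proof (intro conjI allI impI)
  fix U assume U: "openin coset_topology U"
  show "openin (tree_aut_topology d r) {k \<in> topspace (tree_aut_topology d r). aut_to_aa d r k \<in> U}"
    unfolding openin_tree_aut_topology
  proof (intro conjI ballI)
    fix k assume "k \<in> {k \<in> topspace (tree_aut_topology d r). aut_to_aa d r k \<in> U}"
    then have k: "k \<in> tree_aut d r" "aut_to_aa d r k \<in> U" by auto
    then obtain n where
      "\<forall>B\<in>carrier N. inv\<^bsub>N\<^esub> (aut_to_aa d r k) \<otimes>\<^bsub>N\<^esub> B \<in> ball_stab n \<longrightarrow> B \<in> U"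
      using U unfolding openin_coset_topology coset_open_def by blast
    then show "\<exists>n. \<forall>l\<in>tree_aut d r. (\<forall>v\<in>tree_ball n. l v = k v) \<longrightarrow>
        l \<in> {k \<in> topspace (tree_aut_topology d r). aut_to_aa d r k \<in> U}"
      using aut_to_aa_diff_ball_stab[OF k(1)] aut_to_aa_carrier by (intro exI[of _ n]) simp
  qed auto
qed (auto simp: aut_to_aa_carrier)

lemma open_map_aut_to_aa: "open_map (tree_aut_topology d r) coset_topology (aut_to_aa d r)"
  unfolding open_map_def
proof (intro allI impI)
  fix U assume U: "openin (tree_aut_topology d r) U"
  then have sub: "U \<subseteq> tree_aut d r" by (simp add: openin_tree_aut_topology)
  show "openin coset_topology (aut_to_aa d r ` U)"
    unfolding openin_coset_topology coset_open_def
  proof (intro conjI ballI)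
    show "aut_to_aa d r ` U \<subseteq> carrier N" using sub aut_to_aa_carrier by blast
    fix A assume "A \<in> aut_to_aa d r ` U"
    then obtain k where k: "k \<in> U" "A = aut_to_aa d r k" by blast
    then have k': "k \<in> tree_aut d r" using sub by blast
    obtain n where n: "\<forall>l\<in>tree_aut d r. (\<forall>v\<in>tree_ball n. l v = k v) \<longrightarrow> l \<in> U"
      using U k(1) unfolding openin_tree_aut_topology by blast
    have "B \<in> aut_to_aa d r ` U" if B: "B \<in> carrier N" "inv\<^bsub>N\<^esub> A \<otimes>\<^bsub>N\<^esub> B \<in> ball_stab n" for B
    proof -
      have A: "A \<in> carrier N" "A \<in> ball_stab 0"
        using k' by (simp_all add: k(2) aut_to_aa_carrier ball_stab_0)
      \<comment> \<open>\<open>B\<close> differs from an automorphism by an element of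
        \<open>ball_stab n\<close>, hence lies in \<open>ball_stab 0\<close> and is itself an
        automorphism; only then can agreement on the ball be read off.\<close>
      have "A \<otimes>\<^bsub>N\<^esub> (inv\<^bsub>N\<^esub> A \<otimes>\<^bsub>N\<^esub> B) \<in> ball_stab 0"
        using B(2) ball_stab_antimono[of 0 n] by (intro mult_ball_stab[OF A(2)]) blast
      then have "B \<in> ball_stab 0"
        using A B by (simp add: mult_inv_mult)
      then obtain l where l: "l \<in> tree_aut d r" "B = aut_to_aa d r l"
        by (rule ball_stab_aut)
      then have "l \<in> U"
        using n B(2) aut_to_aa_diff_ball_stab[OF k' l(1)] by (simp add: k(2))
      then show ?thesis using l by blast
    qed
    then show "\<exists>n. \<forall>B\<in>carrier N. inv\<^bsub>N\<^esub> A \<otimes>\<^bsub>N\<^esub> B \<in> ball_stab n \<longrightarrow> B \<in> aut_to_aa d r ` U" by blast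
  qed
qed

text \<open>Openness and continuity of the inclusion force the sets \<^term>\<open>ball_stab n\<close> to be a neighbourhood
  basis at the identity.\<close>

lemma neretin_topology_unique:
  assumes T: "topological_group N T"
    and cont: "continuous_map (tree_aut_topology d r) T (aut_to_aa d r)"
    and op: "open_map (tree_aut_topology d r) T (aut_to_aa d r)"
  shows "T = coset_topology"
proof -
  have space: "topspace T = carrier N"
    using T by (simp add: topological_group_def)
  have translate: "openin T {B \<in> carrier N. A \<otimes>\<^bsub>N\<^esub> B \<in> U}" if "openin T U" "A \<in> carrier N" for A U
  proof -
    have "continuous_map T (prod_topology T T) (\<lambda>B. (A, B))"
      using that(2) by (intro continuous_map_pairedI) (auto simp: space)
    moreover have "continuous_map (prod_topology T T) T (\<lambda>(x, y). x \<otimes>\<^bsub>N\<^esub> y)"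
      using T by (simp add: topological_group_def)
    ultimately have "continuous_map T T ((\<lambda>(x, y). x \<otimes>\<^bsub>N\<^esub> y) \<circ> (\<lambda>B. (A, B)))"
      by (rule continuous_map_compose)
    then show ?thesis
      using openin_continuous_map_preimage[OF _ that(1)] by (force simp: o_def space)
  qed
  have "openin (tree_aut_topology d r) {k \<in> tree_aut d r. \<forall>v\<in>tree_ball n. k v = v}" for n
    unfolding openin_tree_aut_topology by (auto intro!: exI[of _ n])
  then have stab: "openin T (ball_stab n)" for n
    using op unfolding open_map_def ball_stab_eq by blast
  have "openin T U \<longleftrightarrow> coset_open U" for U
  proof
    assume U: "openin T U"
    then have sub: "U \<subseteq> carrier N" using openin_subset space by metis
    have "\<exists>n. \<forall>B\<in>carrier N. inv\<^bsub>N\<^esub> A \<otimes>\<^bsub>N\<^esub> B \<in> ball_stab n \<longrightarrow> B \<in> U" if A: "A \<in> U" for A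
    proof -
      have Ac: "A \<in> carrier N" using A sub by blast
      \<comment> \<open>Translating by \<open>A\<close> turns \<open>U\<close> into a neighbourhood
        of the identity, whose preimage under the continuous inclusion contains the pointwise
        stabilizer of some ball.\<close>
      let ?W = "{B \<in> carrier N. A \<otimes>\<^bsub>N\<^esub> B \<in> U}"
      have "openin (tree_aut_topology d r) {k \<in> tree_aut d r. aut_to_aa d r k \<in> ?W}"
        using openin_continuous_map_preimage[OF cont translate[OF U Ac]] by simp
      moreover have "restrict id V \<in> {k \<in> tree_aut d r. aut_to_aa d r k \<in> ?W}"
        using id_tree_aut Ac A N.r_one[OF Ac] N.one_closed by (simp add: neretin_def)
      ultimately obtain n where n: "\<forall>l\<in>tree_aut d r. (\<forall>v\<in>tree_ball n. l v = restrict id V v) \<longrightarrow>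
          l \<in> {k \<in> tree_aut d r. aut_to_aa d r k \<in> ?W}"
        unfolding openin_tree_aut_topology by blast
      then have "ball_stab n \<subseteq> ?W"
        unfolding ball_stab_eq by (auto simp: tree_ball_def)
      then have "A \<otimes>\<^bsub>N\<^esub> (inv\<^bsub>N\<^esub> A \<otimes>\<^bsub>N\<^esub> B) \<in> U"
        if "inv\<^bsub>N\<^esub> A \<otimes>\<^bsub>N\<^esub> B \<in> ball_stab n" for B
        using that by blast
      then show ?thesis
        using mult_inv_mult[OF Ac] by (intro exI[of _ n]) metis
    qed
    then show "coset_open U" using sub by (simp add: coset_open_def)
  next
    assume U: "coset_open U"
    show "openin T U"
      unfolding openin_subopen[of T U]
    proof
      fix A assume A: "A \<in> U"
      then have Ac: "A \<in> carrier N" using U by (auto simp: coset_open_def)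
      obtain n where n: "\<forall>B\<in>carrier N. inv\<^bsub>N\<^esub> A \<otimes>\<^bsub>N\<^esub> B \<in> ball_stab n \<longrightarrow> B \<in> U"
        using U A unfolding coset_open_def by blast
      have "openin T {B \<in> carrier N. inv\<^bsub>N\<^esub> A \<otimes>\<^bsub>N\<^esub> B \<in> ball_stab n}"
        using translate[OF stab] Ac by simp
      then show "\<exists>W. openin T W \<and> A \<in> W \<and> W \<subseteq> U"
        using n Ac by (intro exI[of _ "{B \<in> carrier N. inv\<^bsub>N\<^esub> A \<otimes>\<^bsub>N\<^esub> B \<in> ball_stab n}"]) auto
    qed
  qed
  then show ?thesis
    by (simp add: topology_eq openin_coset_topology)
qed

lemma neretin_topology_eq: "neretin_topology d r = coset_topology"
  unfolding neretin_topology_def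
proof (rule the_equality)
  show "topological_group N coset_topology \<and>
      continuous_map (tree_aut_topology d r) coset_topology (aut_to_aa d r) \<and>
      open_map (tree_aut_topology d r) coset_topology (aut_to_aa d r)"
    by (intro conjI topological_group_coset_topology continuous_map_aut_to_aa open_map_aut_to_aa)
qed (elim conjE, rule neretin_topology_unique)

section \<open>Compactness and closedness of cosets\<close>

lemma compactin_coset:
  assumes A: "A \<in> carrier N"
  shows "compactin coset_topology {B \<in> carrier N. inv\<^bsub>N\<^esub> A \<otimes>\<^bsub>N\<^esub> B \<in> ball_stab 0}"
proof -
  have "compactin coset_topology (ball_stab 0)"
    using image_compactin[OF _ continuous_map_aut_to_aa] compact_space_tree_aut_topology
    by (simp add: compact_space_def ball_stab_0)
  moreover have "continuous_map coset_topology coset_topology (\<lambda>B. A \<otimes>\<^bsub>N\<^esub> B)"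
  proof -
    have "continuous_map coset_topology (prod_topology coset_topology coset_topology) (\<lambda>B. (A, B))"
      using A by (intro continuous_map_pairedI) auto
    moreover have "continuous_map (prod_topology coset_topology coset_topology) coset_topology
        (\<lambda>(x, y). x \<otimes>\<^bsub>N\<^esub> y)"
      using topological_group_coset_topology by (simp add: topological_group_def)
    ultimately show ?thesis
      using continuous_map_compose by (fastforce simp: o_def)
  qed
  ultimately have "compactin coset_topology ((\<lambda>B. A \<otimes>\<^bsub>N\<^esub> B) ` ball_stab 0)"
    by (rule image_compactin)
  moreover have "(\<lambda>B. A \<otimes>\<^bsub>N\<^esub> B) ` ball_stab 0 = {B \<in> carrier N. inv\<^bsub>N\<^esub> A \<otimes>\<^bsub>N\<^esub> B \<in> ball_stab 0}"
  proof
    show "(\<lambda>B. A \<otimes>\<^bsub>N\<^esub> B) ` ball_stab 0 \<subseteq> {B \<in> carrier N. inv\<^bsub>N\<^esub> A \<otimes>\<^bsub>N\<^esub> B \<in> ball_stab 0}"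
      using A ball_stab_carrier by (auto simp flip: N.m_assoc)
    show "{B \<in> carrier N. inv\<^bsub>N\<^esub> A \<otimes>\<^bsub>N\<^esub> B \<in> ball_stab 0} \<subseteq> (\<lambda>B. A \<otimes>\<^bsub>N\<^esub> B) ` ball_stab 0"
    proof
      fix B assume B: "B \<in> {B \<in> carrier N. inv\<^bsub>N\<^esub> A \<otimes>\<^bsub>N\<^esub> B \<in> ball_stab 0}"
      then have "B = A \<otimes>\<^bsub>N\<^esub> (inv\<^bsub>N\<^esub> A \<otimes>\<^bsub>N\<^esub> B)"
        using A by (simp add: mult_inv_mult)
      then show "B \<in> (\<lambda>B. A \<otimes>\<^bsub>N\<^esub> B) ` ball_stab 0" using B by blast
    qed
  qed
  ultimately show ?thesis by simp
qed

text \<open>Distinct left cosets of a subgroup are disjoint, so the complement of an open coset is a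
  union of open cosets.\<close>

lemma closedin_coset:
  assumes A: "A \<in> carrier N"
  shows "closedin coset_topology {B \<in> carrier N. inv\<^bsub>N\<^esub> A \<otimes>\<^bsub>N\<^esub> B \<in> ball_stab n}"
proof -
  have "\<exists>m. \<forall>C\<in>carrier N. inv\<^bsub>N\<^esub> B \<otimes>\<^bsub>N\<^esub> C \<in> ball_stab m \<longrightarrow> inv\<^bsub>N\<^esub> A \<otimes>\<^bsub>N\<^esub> C \<notin> ball_stab n"
    if B: "B \<in> carrier N" "inv\<^bsub>N\<^esub> A \<otimes>\<^bsub>N\<^esub> B \<notin> ball_stab n" for B
  proof (intro exI[of _ n] ballI impI notI)
    fix C assume C: "C \<in> carrier N" "inv\<^bsub>N\<^esub> B \<otimes>\<^bsub>N\<^esub> C \<in> ball_stab n" "inv\<^bsub>N\<^esub> A \<otimes>\<^bsub>N\<^esub> C \<in> ball_stab n"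
    have "inv\<^bsub>N\<^esub> (inv\<^bsub>N\<^esub> B \<otimes>\<^bsub>N\<^esub> C) = inv\<^bsub>N\<^esub> C \<otimes>\<^bsub>N\<^esub> B"
      using B C by (simp add: N.inv_mult_group)
    then have "(inv\<^bsub>N\<^esub> A \<otimes>\<^bsub>N\<^esub> C) \<otimes>\<^bsub>N\<^esub> (inv\<^bsub>N\<^esub> C \<otimes>\<^bsub>N\<^esub> B) \<in> ball_stab n"
      using C inv_ball_stab mult_ball_stab by metis
    then show False
      using inv_mult_cancel[OF A C(1) B(1)] B(2) by simp
  qed
  then have "coset_open (carrier N - {B \<in> carrier N. inv\<^bsub>N\<^esub> A \<otimes>\<^bsub>N\<^esub> B \<in> ball_stab n})"
    unfolding coset_open_def by auto
  then show ?thesis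
    by (auto simp: closedin_def openin_coset_topology)
qed

end

section \<open>The commensurating action\<close>

context tree_params
begin

section \<open>Properness: few bad vertices leave finitely many cosets\<close>

lemma co_roots_length_le:
  assumes F: "adm F" and v: "v \<in> rts F"
  shows "length v \<le> card F"
proof (cases v rule: rev_cases)
  case (snoc u i)
  then have "u \<in> F" using v by (simp add: co_roots_iff[OF F])
  then show ?thesis
    using admissible_length_less[OF F] snoc by fastforce
qed simp

text \<open>If the inverse were defined at the parent of \<open>w\<close>, it would send that parent
  to the parent of \<open>v\<close>, so \<open>A\<close> would be defined there; but the parent of
  \<open>v\<close> is bad. This bounds the depth of \<open>w\<close> through the bad vertices of the
  inverse.\<close>

lemma moves_co_roots_bad_verts:
  assumes A: "A \<in> carrier N" and v: "v \<in> rts (bad_verts A)" and vw: "moves A v w"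
  shows "w \<in> rts (bad_verts (inv\<^bsub>N\<^esub> A))"
proof -
  have iA: "inv\<^bsub>N\<^esub> A \<in> carrier N" using A by simp
  have wv: "moves (inv\<^bsub>N\<^esub> A) w v" using moves_inv[OF A vw] .
  have "u \<in> bad_verts (inv\<^bsub>N\<^esub> A)" if uw: "is_child u w" for u
  proof (rule ccontr)
    obtain i where w: "w = u @ [i]" using uw by (auto simp: is_child_def)
    have wV: "w \<in> V" using moves_in_V[OF A vw] by blast
    then have "u \<in> V" by (simp add: w snoc_in_V)
    moreover assume "u \<notin> bad_verts (inv\<^bsub>N\<^esub> A)"
    ultimately obtain x where x: "moves (inv\<^bsub>N\<^esub> A) u x"
      by (auto simp: bad_verts_def)
    then obtain j where "moves (inv\<^bsub>N\<^esub> A) w (x @ [j])"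
      using moves_child[OF iA x, of i] wV w by auto
    then have "v = x @ [j]"
      using moves_unique[OF iA wv] by simp
    then have "x \<in> bad_verts A"
      using v by (simp add: co_roots_iff[OF admissible_bad_verts[OF A]])
    moreover have "moves A x u"
      using moves_inv[OF iA x] A by simp
    ultimately show False by (auto simp: bad_verts_def)
  qed
  moreover have "w \<in> V" "w \<notin> bad_verts (inv\<^bsub>N\<^esub> A)"
    using moves_in_V[OF A vw] wv by (auto simp: bad_verts_def)
  ultimately show ?thesis
    by (simp add: co_roots_iff[OF admissible_bad_verts[OF iA]])
qed

text \<open>An almost automorphism is determined modulo \<^term>\<open>ball_stab 0\<close> by the images of the roots of
  its domain, which have bounded length when few vertices are bad.\<close>

lemma bounded_bad_verts_compact:
  "\<exists>C. compactin coset_topology C \<and> closedin coset_topology C \<and>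
    {A \<in> carrier N. card (bad_verts A) \<le> n \<and> card (bad_verts (inv\<^bsub>N\<^esub> A)) \<le> n} \<subseteq> C"
proof -
  let ?S = "{A \<in> carrier N. card (bad_verts A) \<le> n \<and> card (bad_verts (inv\<^bsub>N\<^esub> A)) \<le> n}"
  \<comment> \<open>Radius \<open>n\<close> is enough: roots of the complement of an admissible set
    with at most \<open>n\<close> elements have length at most \<open>n\<close>, both on the source
    and on the target side.\<close>
  define data where "data A = {p \<in> tree_ball n \<times> tree_ball n. moves A (fst p) (snd p)}" for A
  have "data ` ?S \<subseteq> Pow (tree_ball n \<times> tree_ball n)"
    by (auto simp: data_def)
  then have "finite (data ` ?S)"
    by (rule finite_subset) simp
  \<comment> \<open>One element is kept for each of the finitely many patterns, so \<open>C\<close>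
    will be a finite union of cosets.\<close>
  then obtain S0 where S0: "S0 \<subseteq> ?S" "finite S0" "data ` ?S = data ` S0"
    using finite_subset_image[of "data ` ?S" data ?S] by auto
  let ?coset = "\<lambda>A. {B \<in> carrier N. inv\<^bsub>N\<^esub> A \<otimes>\<^bsub>N\<^esub> B \<in> ball_stab 0}"
  define C where "C = \<Union> (?coset ` S0)"
  have "compactin coset_topology C"
    unfolding C_def using S0 compactin_coset by (intro compactin_Union) auto
  moreover have "closedin coset_topology C"
    unfolding C_def using S0 closedin_coset by (intro closedin_Union) auto
  moreover have "?S \<subseteq> C"
  proof
    fix B assume B: "B \<in> ?S"
    then obtain A where A: "A \<in> S0" "data B = data A"
      using S0(3) by (metis (no_types, lifting) imageE imageI)
    have carr: "A \<in> carrier N" "B \<in> carrier N" using A B S0 by auto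
    have card: "card (bad_verts A) \<le> n" "card (bad_verts (inv\<^bsub>N\<^esub> A)) \<le> n"
      using A S0 by auto
    have iA: "inv\<^bsub>N\<^esub> A \<in> carrier N" using carr by simp
    have fixed: "moves (inv\<^bsub>N\<^esub> A \<otimes>\<^bsub>N\<^esub> B) v v" if v: "v \<in> rts (bad_verts A)" for v
    proof -
      have vV: "v \<in> V" "v \<notin> bad_verts A"
        using v by (simp_all add: co_roots_iff[OF admissible_bad_verts[OF carr(1)]])
      then obtain w where w: "moves A v w" by (auto simp: bad_verts_def)
      have "length v \<le> n"
        using co_roots_length_le[OF admissible_bad_verts[OF carr(1)] v] card by simp
      moreover have "length w \<le> n"
        using co_roots_length_le[OF admissible_bad_verts[OF iA] moves_co_roots_bad_verts[OF carr(1) v w]]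
          card by simp
      ultimately have "(v, w) \<in> data A"
        using w vV moves_in_V[OF carr(1) w] by (simp add: data_def tree_ball_def)
      then have "moves B v w"
        unfolding A(2)[symmetric] by (simp add: data_def)
      then show ?thesis
        using moves_mult[OF iA carr(2) _ moves_inv[OF carr(1) w]] by blast
    qed
    have "inv\<^bsub>N\<^esub> A \<otimes>\<^bsub>N\<^esub> B \<in> carrier N" using iA carr by simp
    then obtain k where "k \<in> tree_aut d r" "inv\<^bsub>N\<^esub> A \<otimes>\<^bsub>N\<^esub> B = aut_to_aa d r k"
      using moves_co_roots_imp_aut[OF _ admissible_bad_verts[OF carr(1)] fixed] by metis
    then have "inv\<^bsub>N\<^esub> A \<otimes>\<^bsub>N\<^esub> B \<in> ball_stab 0"
      by (simp add: ball_stab_0)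
    then show "B \<in> C"
      using A(1) carr by (auto simp: C_def)
  qed
  ultimately show ?thesis by blast
qed

text \<open>\<open>marked A v\<close> stands for the subtree below \<open>v\<close> together with its embedding by \<open>A\<close> into the
  boundary, up to automorphisms of the subtree. These points are represented by pairs in order to
  match the index type in \<^const>\<open>a_T_menable\<close>.\<close>

definition marked :: "aa_triple set \<Rightarrow> nat list \<Rightarrow> aa_triple set \<times> nat" where
  "marked A v = (SOME p. \<exists>B w. p = (B, to_nat w) \<and> B \<in> carrier N \<and> w \<in> V \<and>
    moves (inv\<^bsub>N\<^esub> B \<otimes>\<^bsub>N\<^esub> A) v w)"

lemma markedE:
  assumes "A \<in> carrier N" "v \<in> V"
  obtains B w where "marked A v = (B, to_nat w)" "B \<in> carrier N" "w \<in> V"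
    "moves (inv\<^bsub>N\<^esub> B \<otimes>\<^bsub>N\<^esub> A) v w"
proof -
  let ?P = "\<lambda>p. \<exists>B w. p = (B, to_nat w) \<and> B \<in> carrier N \<and> w \<in> V \<and> moves (inv\<^bsub>N\<^esub> B \<otimes>\<^bsub>N\<^esub> A) v w"
  have "?P (A, to_nat v)"
    using assms moves_one by auto
  then have "?P (marked A v)"
    unfolding marked_def by (rule someI)
  then show ?thesis using that by blast
qed

lemma moves_diff_trans:
  assumes "A \<in> carrier N" "B \<in> carrier N" "C \<in> carrier N"
    and "moves (inv\<^bsub>N\<^esub> B \<otimes>\<^bsub>N\<^esub> C) u v" "moves (inv\<^bsub>N\<^esub> A \<otimes>\<^bsub>N\<^esub> B) v w"
  shows "moves (inv\<^bsub>N\<^esub> A \<otimes>\<^bsub>N\<^esub> C) u w"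
  using moves_mult[OF _ _ assms(4,5)] assms(1-3) by (simp add: inv_mult_cancel)

lemma moves_diff_sym:
  assumes "A \<in> carrier N" "B \<in> carrier N" and "moves (inv\<^bsub>N\<^esub> A \<otimes>\<^bsub>N\<^esub> B) v w"
  shows "moves (inv\<^bsub>N\<^esub> B \<otimes>\<^bsub>N\<^esub> A) w v"
  using moves_inv[OF _ assms(3)] assms(1,2) by (simp add: N.inv_mult_group)

text \<open>The right-hand side is an equivalence relation on pairs. The chosen pair is equivalent
  to the pair it represents, which gives one direction; equivalent pairs present the same predicate
  to \<open>SOME\<close>, which gives the other.\<close>

lemma marked_eq_iff:
  assumes A: "A \<in> carrier N" "v \<in> V" and B: "B \<in> carrier N" "w \<in> V"
  shows "marked A v = marked B w \<longleftrightarrow> moves (inv\<^bsub>N\<^esub> B \<otimes>\<^bsub>N\<^esub> A) v w"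
proof
  assume eq: "marked A v = marked B w"
  obtain A' v' where A': "marked A v = (A', to_nat v')" "A' \<in> carrier N"
    "moves (inv\<^bsub>N\<^esub> A' \<otimes>\<^bsub>N\<^esub> A) v v'"
    using markedE[OF A] by metis
  obtain B' w' where B': "marked B w = (B', to_nat w')" "B' \<in> carrier N"
    "moves (inv\<^bsub>N\<^esub> B' \<otimes>\<^bsub>N\<^esub> B) w w'"
    using markedE[OF B] by metis
  have "A' = B'" "v' = w'" using eq A'(1) B'(1) by simp_all
  then show "moves (inv\<^bsub>N\<^esub> B \<otimes>\<^bsub>N\<^esub> A) v w"
    using moves_diff_trans[OF B(1) A'(2) A(1) A'(3)] moves_diff_sym[OF B'(2) B(1) B'(3)] by simp
next
  assume vw: "moves (inv\<^bsub>N\<^esub> B \<otimes>\<^bsub>N\<^esub> A) v w"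
  have "moves (inv\<^bsub>N\<^esub> C \<otimes>\<^bsub>N\<^esub> A) v u \<longleftrightarrow> moves (inv\<^bsub>N\<^esub> C \<otimes>\<^bsub>N\<^esub> B) w u" if C: "C \<in> carrier N" for C u
    using moves_diff_trans[OF C B(1) A(1) vw] moves_diff_trans[OF C A(1) B(1)]
      moves_diff_sym[OF B(1) A(1) vw] by blast
  then show "marked A v = marked B w"
    unfolding marked_def by (intro arg_cong[where f = Eps] ext) blast
qed

section \<open>The action on embedded balls and its commensurated set\<close>

definition marked_points :: "(aa_triple set \<times> nat) set" where
  "marked_points = (\<lambda>(A, v). marked A v) ` (carrier N \<times> V)"

text \<open>\<open>commensurating_action\<close> asks for an action on the whole type, so pairs that
  represent no embedded ball are left fixed.\<close>

definition mark_act :: "aa_triple set \<Rightarrow> aa_triple set \<times> nat \<Rightarrow> aa_triple set \<times> nat" where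
  "mark_act g p = (if p \<in> marked_points then marked (g \<otimes>\<^bsub>N\<^esub> fst p) (from_nat (snd p)) else p)"

lemma marked_in_points: "A \<in> carrier N \<Longrightarrow> v \<in> V \<Longrightarrow> marked A v \<in> marked_points"
  by (auto simp: marked_points_def)

lemma left_translate_diff:
  "g \<in> carrier N \<Longrightarrow> A \<in> carrier N \<Longrightarrow> B \<in> carrier N \<Longrightarrow>
    inv\<^bsub>N\<^esub> (g \<otimes>\<^bsub>N\<^esub> B) \<otimes>\<^bsub>N\<^esub> (g \<otimes>\<^bsub>N\<^esub> A) = inv\<^bsub>N\<^esub> B \<otimes>\<^bsub>N\<^esub> A"
  using mult_inv_mult[of "inv\<^bsub>N\<^esub> g" A] by (simp add: N.inv_mult_group N.m_assoc)

text \<open>The definition acts on the chosen representative. Left translation by \<open>g\<close>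
  cancels in the quotients that define the equivalence, so any representative gives the same
  result.\<close>

lemma mark_act_marked:
  assumes g: "g \<in> carrier N" and A: "A \<in> carrier N" "v \<in> V"
  shows "mark_act g (marked A v) = marked (g \<otimes>\<^bsub>N\<^esub> A) v"
proof -
  obtain B w where B: "marked A v = (B, to_nat w)" "B \<in> carrier N" "w \<in> V"
    "moves (inv\<^bsub>N\<^esub> B \<otimes>\<^bsub>N\<^esub> A) v w"
    using markedE[OF A] .
  have "marked (g \<otimes>\<^bsub>N\<^esub> B) w = marked (g \<otimes>\<^bsub>N\<^esub> A) v"
    using g A B moves_diff_sym[OF B(2) A(1) B(4)]
    by (subst marked_eq_iff) (simp_all add: left_translate_diff)
  then show ?thesis
    using marked_in_points[OF A] B(1) by (simp add: mark_act_def)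
qed

definition standard_points :: "(aa_triple set \<times> nat) set" where
  "standard_points = marked \<one>\<^bsub>N\<^esub> ` V"

lemma mark_act_standard:
  "g \<in> carrier N \<Longrightarrow> mark_act g ` standard_points = marked g ` V"
  by (auto simp: standard_points_def mark_act_marked image_iff)

lemma inj_on_marked: "A \<in> carrier N \<Longrightarrow> inj_on (marked A) V"
  using moves_unique[OF N.one_closed moves_one] by (auto intro!: inj_onI simp: marked_eq_iff)

text \<open>\<open>marked g v\<close> coincides with the standard point of \<open>w\<close> exactly
  when \<open>g\<close> moves \<open>v\<close> to \<open>w\<close>, so it is standard unless
  \<open>v\<close> is bad. The second equality is the same argument for the inverse of
  \<open>g\<close>.\<close>

lemma
  assumes g: "g \<in> carrier N"
  shows mark_act_standard_diff: "mark_act g ` standard_points - standard_points = marked g ` bad_verts g"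
    and standard_diff_mark_act:
      "standard_points - mark_act g ` standard_points = marked \<one>\<^bsub>N\<^esub> ` bad_verts (inv\<^bsub>N\<^esub> g)"
proof -
  have image_diff: "f ` V - T = f ` B" if "B \<subseteq> V" "\<And>v. v \<in> V \<Longrightarrow> f v \<in> T \<longleftrightarrow> v \<notin> B"
    for f :: "nat list \<Rightarrow> aa_triple set \<times> nat" and T B
    using that by blast
  have bad: "bad_verts A \<subseteq> V" for A
    by (auto simp: bad_verts_def)
  have 1: "marked g v \<in> standard_points \<longleftrightarrow> v \<notin> bad_verts g" if "v \<in> V" for v
  proof -
    have "marked g v \<in> standard_points \<longleftrightarrow> (\<exists>w\<in>V. moves g v w)"
      using g that by (auto simp: standard_points_def image_iff marked_eq_iff)
    then show ?thesis
      using that moves_in_V[OF g] by (auto simp: bad_verts_def)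
  qed
  then show "mark_act g ` standard_points - standard_points = marked g ` bad_verts g"
    unfolding mark_act_standard[OF g] by (rule image_diff[OF bad])
  have 2: "marked \<one>\<^bsub>N\<^esub> v \<in> mark_act g ` standard_points \<longleftrightarrow> v \<notin> bad_verts (inv\<^bsub>N\<^esub> g)"
    if "v \<in> V" for v
  proof -
    have ig: "inv\<^bsub>N\<^esub> g \<in> carrier N" using g by simp
    have "marked \<one>\<^bsub>N\<^esub> v \<in> mark_act g ` standard_points \<longleftrightarrow> (\<exists>w\<in>V. moves (inv\<^bsub>N\<^esub> g) v w)"
      using g that by (auto simp: mark_act_standard image_iff marked_eq_iff)
    then show ?thesis
      using that moves_in_V[OF ig] by (auto simp: bad_verts_def)
  qed
  have "marked \<one>\<^bsub>N\<^esub> ` V - mark_act g ` standard_points = marked \<one>\<^bsub>N\<^esub> ` bad_verts (inv\<^bsub>N\<^esub> g)"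
    using 2 by (rule image_diff[OF bad])
  then show "standard_points - mark_act g ` standard_points = marked \<one>\<^bsub>N\<^esub> ` bad_verts (inv\<^bsub>N\<^esub> g)"
    by (simp only: standard_points_def)
qed

lemma finite_bad_verts: "A \<in> carrier N \<Longrightarrow> finite (bad_verts A)"
  using admissible_bad_verts by (simp add: admissible_def)

lemma card_sym_diff_standard:
  assumes g: "g \<in> carrier N"
  shows "finite (sym_diff (mark_act g ` standard_points) standard_points)"
    and "card (sym_diff (mark_act g ` standard_points) standard_points) =
      card (bad_verts g) + card (bad_verts (inv\<^bsub>N\<^esub> g))"
proof -
  have fin: "finite (bad_verts g)" "finite (bad_verts (inv\<^bsub>N\<^esub> g))"
    using g by (simp_all add: finite_bad_verts)
  have inj: "inj_on (marked g) (bad_verts g)" "inj_on (marked \<one>\<^bsub>N\<^esub>) (bad_verts (inv\<^bsub>N\<^esub> g))"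
    using inj_on_marked[OF g] inj_on_marked[OF N.one_closed]
    by (auto intro: inj_on_subset simp: bad_verts_def)
  show "finite (sym_diff (mark_act g ` standard_points) standard_points)"
    using fin by (simp add: mark_act_standard_diff standard_diff_mark_act g)
  have "card (sym_diff (mark_act g ` standard_points) standard_points) =
      card (mark_act g ` standard_points - standard_points) +
      card (standard_points - mark_act g ` standard_points)"
    using fin by (intro card_Un_disjoint) (simp_all add: mark_act_standard_diff standard_diff_mark_act g,
        use mark_act_standard_diff[OF g] standard_diff_mark_act[OF g] in blast)
  then show "card (sym_diff (mark_act g ` standard_points) standard_points) =
      card (bad_verts g) + card (bad_verts (inv\<^bsub>N\<^esub> g))"
    using inj by (simp add: mark_act_standard_diff standard_diff_mark_act g card_image)
qed

lemma ball_stab_0_bad_verts: "A \<in> ball_stab 0 \<Longrightarrow> bad_verts A = {}"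
  using moves_aut by (fastforce simp: ball_stab_0 bad_verts_def)

lemma commensurating_action_neretin:
  "commensurating_action N (neretin_topology d r) mark_act standard_points"
  unfolding neretin_topology_eq
proof
  show "topological_group N coset_topology"
    by (rule topological_group_coset_topology)
  show "mark_act \<one>\<^bsub>N\<^esub> p = p" for p
  proof (cases "p \<in> marked_points")
    case True
    then show ?thesis by (auto simp: marked_points_def mark_act_marked)
  qed (simp add: mark_act_def)
  show "mark_act (g \<otimes>\<^bsub>N\<^esub> h) p = mark_act g (mark_act h p)"
    if "g \<in> carrier N" "h \<in> carrier N" for g h p
  proof (cases "p \<in> marked_points")
    case True
    then show ?thesis
      using that by (auto simp: marked_points_def mark_act_marked N.m_assoc)
  qed (simp add: mark_act_def)
  show "finite (sym_diff (mark_act g ` standard_points) standard_points)" if "g \<in> carrier N" for g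
    using that by (rule card_sym_diff_standard)
  have open_stab: "openin coset_topology (ball_stab m)" for m
  proof -
    have "{B \<in> carrier N. inv\<^bsub>N\<^esub> \<one>\<^bsub>N\<^esub> \<otimes>\<^bsub>N\<^esub> B \<in> ball_stab m} = ball_stab m"
      using ball_stab_carrier by auto
    then show ?thesis
      using coset_open_coset[OF N.one_closed, of m] by (simp only: openin_coset_topology)
  qed
  show "\<exists>U. openin coset_topology U \<and> \<one>\<^bsub>N\<^esub> \<in> U \<and> (\<forall>g\<in>U. mark_act g p = p)" for p
  proof (cases "p \<in> marked_points")
    case True
    then obtain A v where p: "p = marked A v" and A: "A \<in> carrier N" "v \<in> V"
      by (auto simp: marked_points_def)
    \<comment> \<open>The stabilizer of \<open>marked A v\<close> is the conjugate by
      \<open>A\<close> of the set of elements moving \<open>v\<close> to itself, and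
      \<open>v\<close> lies in the ball of radius \<open>length v\<close>.\<close>
    obtain m where m: "\<forall>B\<in>ball_stab m. inv\<^bsub>N\<^esub> A \<otimes>\<^bsub>N\<^esub> B \<otimes>\<^bsub>N\<^esub> A \<in> ball_stab (length v)"
      using conj_ball_stab[OF A(1)] by blast
    have "mark_act g p = p" if g: "g \<in> ball_stab m" for g
    proof -
      have gc: "g \<in> carrier N" using g by (rule ball_stab_carrier)
      have "moves (inv\<^bsub>N\<^esub> A \<otimes>\<^bsub>N\<^esub> g \<otimes>\<^bsub>N\<^esub> A) v v"
        using m g A by (auto simp: ball_stab_def tree_ball_def)
      then have "moves (inv\<^bsub>N\<^esub> A \<otimes>\<^bsub>N\<^esub> (g \<otimes>\<^bsub>N\<^esub> A)) v v"
        using gc A by (simp add: N.m_assoc)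
      then show ?thesis
        using gc A by (simp add: p mark_act_marked marked_eq_iff)
    qed
    then show ?thesis
      using open_stab[of m] one_ball_stab[of m] by blast
  next
    case False
    then show ?thesis
      using open_stab[of 0] one_ball_stab[of 0] by (auto simp: mark_act_def)
  qed
  show "\<exists>U. openin coset_topology U \<and> \<one>\<^bsub>N\<^esub> \<in> U \<and> (\<forall>g\<in>U. mark_act g ` standard_points = standard_points)"
  proof (intro exI[of _ "ball_stab 0"] conjI ballI)
    fix g assume g: "g \<in> ball_stab 0"
    have gc: "g \<in> carrier N" using g by (rule ball_stab_carrier)
    \<comment> \<open>Tree automorphisms are defined at every vertex, so both halves of the
      symmetric difference are empty.\<close>
    have "bad_verts g = {}" "bad_verts (inv\<^bsub>N\<^esub> g) = {}"
      using g inv_ball_stab ball_stab_0_bad_verts by blast+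
    then show "mark_act g ` standard_points = standard_points"
      using mark_act_standard_diff[OF gc] standard_diff_mark_act[OF gc] by simp
  qed (simp_all add: open_stab)
  show "\<exists>C. compactin coset_topology C \<and> closedin coset_topology C \<and>
      {g \<in> carrier N. card (sym_diff (mark_act g ` standard_points) standard_points) \<le> n} \<subseteq> C" for n
  proof -
    obtain C where C: "compactin coset_topology C" "closedin coset_topology C"
      "{A \<in> carrier N. card (bad_verts A) \<le> n \<and> card (bad_verts (inv\<^bsub>N\<^esub> A)) \<le> n} \<subseteq> C"
      using bounded_bad_verts_compact by blast
    moreover have "{g \<in> carrier N. card (sym_diff (mark_act g ` standard_points) standard_points) \<le> n} \<subseteq>
        {A \<in> carrier N. card (bad_verts A) \<le> n \<and> card (bad_verts (inv\<^bsub>N\<^esub> A)) \<le> n}"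
      using card_sym_diff_standard(2) by auto
    ultimately show ?thesis by blast
  qed
qed

end

theorem theorem4p16:
  fixes d r :: nat
  assumes "d \<ge> 2" and "r \<ge> 1"
  shows "a_T_menable (neretin d r) (neretin_topology d r)"
proof -
  interpret tree_params d r
    using assms by unfold_locales auto
  show ?thesis
    by (rule commensurating_action_imp_a_T_menable[OF commensurating_action_neretin])
qed

end
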